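(* Let $A:\mathbb N\to\mathbb C^{s\times s}$ have $A(0)$ nonsingular, and let $N$ be the number of coefficients $A^{(-1)}(0),\ldots,A^{(-1)}(N-1)$ of the convolution inverse that are required. Under FFT multiplication of scalar series, the recursive inverse requires $\mathcal O(s^3N^2)$ arithmetic operations; Newton inversion requires $\mathcal O(s^2N\log N+s^3N)$ arithmetic operations; and Gauss–Jordan elimination over $\mathbb C[[x]]/\langle x^N\rangle$ requires $\mathcal O(s^3N\log N)$ arithmetic operations. All three methods require $\mathcal O(s^2N)$ coefficient storage. For fixed $s$, the two FFT-based methods (Newton and Gauss–Jordan) are quasi-linear in $N$, i.e. use $\mathcal O(N\log N)$ operations.
   Context: Convolution of matrix sequences: $(A*B)(k)=\sum_{\ell=0}^kA(\ell)B(k-\ell)$; $e_0(0)=I_s$, $e_0(k)=0$ for $k\ge1$; $A^{(-1)}$ is the two-sided convolution inverse; $P_A(x)=\sum_kA(k)x^k$. The implied constants are absolute (independent of $s$ and $N$), with $N\ge2$. Cost model: arithmetic operations in $\mathbb C$ are counted; a product (or inverse) of $s\times s$ scalar matrices by the standard algorithm costs $\mathcal O(s^3)$; a length-$L$ FFT or inverse FFT ($L$ a power of two) costs $\mathcal O(L\log L)$. Two scalar series of length $m$ are multiplied by zero-padding to a power of two $L\ge2m-1$, FFT, pointwise multiplication, and inverse FFT. Two matrix series of length $m$ are multiplied by zero-padding, entrywise FFTs, one $s\times s$ matrix product per frequency, and entrywise inverse FFTs. Recursive inverse: $A^{(-1)}(0)=A(0)^{-1}$ and $A^{(-1)}(k)=-\sum_{\ell=0}^{k-1}A^{(-1)}(\ell)A(k-\ell)A(0)^{-1}$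 for $k=1,\ldots,N-1$, evaluated directly. Newton inversion: $B_0$ is concentrated at zero with $B_0(0)=A(0)^{-1}$; then $B_{r+1}=B_r*(2e_0-A*B_r)\pmod{x^{2^{r+1}}}$ with matrix-series FFT products, until $N$ coefficients are obtained (the last step being truncated if $N$ is not a power of two). Gauss–Jordan: row-reduce the augmented matrix $[P_A(x)\mid I_s]$ over $\mathbb C[[x]]/\langle x^N\rangle$; at column $i$ a row permutation selects a pivot with nonzero constant coefficient, the pivot series is inverted by scalar Newton iteration (cost $\mathcal O(N\log N)$), the pivot row is normalized, and the remaining entries of the column are eliminated, using truncated scalar-series FFT products; after $s$ steps the right block is $P_A(x)^{-1}$ modulo $x^N$. *)

theory Defs
  imports
    Complex_Main
    "HOL-Library.Log_Nat"
    "HOL-Library.Monad_Syntax"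
    "Jordan_Normal_Form.Matrix"
begin

section \<open>Convolution of matrix sequences\<close>

text \<open>The addition of \<^typ>\<open>complex mat\<close> has no dimension-independent zero, so the sum of
  matrices is taken entrywise.\<close>

definition conv :: "nat \<Rightarrow> (nat \<Rightarrow> complex mat) \<Rightarrow> (nat \<Rightarrow> complex mat) \<Rightarrow> nat \<Rightarrow> complex mat" where
  "conv s A B k = mat s s (\<lambda>(i, j). \<Sum>l\<le>k. (A l * B (k - l)) $$ (i, j))"

definition e0 :: "nat \<Rightarrow> nat \<Rightarrow> complex mat" where
  "e0 s k = (if k = 0 then 1\<^sub>m s else 0\<^sub>m s s)"

definition conv_inverse :: "nat \<Rightarrow> (nat \<Rightarrow> complex mat) \<Rightarrow> nat \<Rightarrow> complex mat" where
  "conv_inverse s A =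
    (THE B. (\<forall>k. B k \<in> carrier_mat s s) \<and> conv s A B = e0 s \<and> conv s B A = e0 s)"

definition coeffs :: "nat \<Rightarrow> (nat \<Rightarrow> complex mat) \<Rightarrow> complex list list list" where
  "coeffs N A = map (\<lambda>k. mat_to_list (A k)) [0..<N]"


section \<open>Computations with operation and storage count\<close>

text \<open>Algorithms are written in a monad that counts arithmetic operations in the complex numbers
  and the peak number of complex coefficients that are stored. Only the four arithmetic operations
  below are charged; indexing, copying, zero-padding, permuting rows and comparing with zero are
  data movement.\<close>

class storable =
  fixes cells :: "'a \<Rightarrow> nat"

instantiation complex :: storable
begin
definition cells_complex :: "complex \<Rightarrow> nat" where
  "cells_complex z = 1"
instance ..
end

instantiation list :: (storable) storable
begin
definition cells_list :: "'a list \<Rightarrow> nat" where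
  "cells_list xs = sum_list (map cells xs)"
instance ..
end

text \<open>\<^term>\<open>peak c\<close> is the largest number of coefficients simultaneously held in storage
  that is allocated during \<^term>\<open>c\<close>, including its result but not the data that were already
  stored when \<^term>\<open>c\<close> was started.\<close>

datatype 'a comp = Comp (result: 'a) (ops: nat) (peak: nat)

definition return :: "'a::storable \<Rightarrow> 'a comp" where
  "return x = Comp x 0 (cells x)"

text \<open>A value bound to a variable stays in storage to the end of the scope of the variable.\<close>

definition bind_comp :: "'a::storable comp \<Rightarrow> ('a \<Rightarrow> 'b comp) \<Rightarrow> 'b comp" where
  "bind_comp c f =
    (let d = f (result c)
     in Comp (result d) (ops c + ops d) (max (peak c) (cells (result c) + peak d)))"

adhoc_overloading Monad_Syntax.bind \<rightleftharpoons> bind_comp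

definition addM :: "complex \<Rightarrow> complex \<Rightarrow> complex comp" where
  "addM x y = Comp (x + y) 1 1"

definition subM :: "complex \<Rightarrow> complex \<Rightarrow> complex comp" where
  "subM x y = Comp (x - y) 1 1"

definition mulM :: "complex \<Rightarrow> complex \<Rightarrow> complex comp" where
  "mulM x y = Comp (x * y) 1 1"

definition divM :: "complex \<Rightarrow> complex \<Rightarrow> complex comp" where
  "divM x y = Comp (x / y) 1 1"

primrec mapM :: "('i \<Rightarrow> 'a::storable comp) \<Rightarrow> 'i list \<Rightarrow> 'a list comp" where
  "mapM f [] = return []"
| "mapM f (i # js) = do { y \<leftarrow> f i; ys \<leftarrow> mapM f js; return (y # ys) }"

text \<open>A loop, run through a list of indices, that updates a state. During a pass the old state is
  still stored next to what the pass allocates; after the pass the new state replaces the old one.\<close>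

primrec loopM :: "('i \<Rightarrow> 'a \<Rightarrow> 'a comp) \<Rightarrow> 'i list \<Rightarrow> 'a::storable \<Rightarrow> 'a comp" where
  "loopM f [] a = return a"
| "loopM f (i # js) a =
    (let c = f i a; d = loopM f js (result c)
     in Comp (result d) (ops c + ops d) (max (cells a + peak c) (peak d)))"


section \<open>Scalar matrices by the standard algorithms\<close>

text \<open>Matrices are lists of rows.\<close>

definition mat_addM :: "nat \<Rightarrow> complex list list \<Rightarrow> complex list list \<Rightarrow> complex list list comp" where
  "mat_addM s X Y = mapM (\<lambda>i. mapM (\<lambda>j. addM (X ! i ! j) (Y ! i ! j)) [0..<s]) [0..<s]"

definition mat_negM :: "nat \<Rightarrow> complex list list \<Rightarrow> complex list list comp" where
  "mat_negM s X = mapM (\<lambda>i. mapM (\<lambda>j. subM 0 (X ! i ! j)) [0..<s]) [0..<s]"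

definition mat_mulM :: "nat \<Rightarrow> complex list list \<Rightarrow> complex list list \<Rightarrow> complex list list comp" where
  "mat_mulM s X Y =
    mapM (\<lambda>i. mapM (\<lambda>j.
      loopM (\<lambda>k acc. do { p \<leftarrow> mulM (X ! i ! k) (Y ! k ! j); addM acc p }) [0..<s] 0)
    [0..<s]) [0..<s]"

text \<open>Gauss--Jordan reduction of an augmented matrix with \<^term>\<open>s\<close> rows and
  \<^term>\<open>2 * s\<close> columns, for entries with inversion \<^term>\<open>inve\<close>, multiplication
  \<^term>\<open>mul\<close> and subtraction \<^term>\<open>sub\<close>. At column \<^term>\<open>i\<close> the row number
  \<^term>\<open>pv i W\<close> is exchanged with row number \<^term>\<open>i\<close>.\<close>

definition swap_rows :: "nat \<Rightarrow> nat \<Rightarrow> 'a list \<Rightarrow> 'a list" where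
  "swap_rows i p W = W[i := W ! p, p := W ! i]"

definition gauss_jordan ::
  "('a::storable \<Rightarrow> 'a comp) \<Rightarrow> ('a \<Rightarrow> 'a \<Rightarrow> 'a comp) \<Rightarrow> ('a \<Rightarrow> 'a \<Rightarrow> 'a comp) \<Rightarrow>
   (nat \<Rightarrow> 'a list list \<Rightarrow> nat) \<Rightarrow> nat \<Rightarrow> 'a list list \<Rightarrow> 'a list list comp" where
  "gauss_jordan inve mul sub pv s =
    loopM (\<lambda>i W0. do {
      W \<leftarrow> return (swap_rows i (pv i W0) W0);
      q \<leftarrow> inve (W ! i ! i);
      row \<leftarrow> mapM (\<lambda>j. mul q (W ! i ! j)) [0..<2 * s];
      mapM (\<lambda>r.
        if r = i then return row
        else mapM (\<lambda>j. do { t \<leftarrow> mul (W ! r ! i) (row ! j); sub (W ! r ! j) t }) [0..<2 * s])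
      [0..<s] }) [0..<s]"

definition pivot_rule :: "('a \<Rightarrow> bool) \<Rightarrow> (nat \<Rightarrow> 'a list list \<Rightarrow> nat) \<Rightarrow> bool" where
  "pivot_rule ok pv \<longleftrightarrow>
    (\<forall>i W. (\<exists>r. i \<le> r \<and> r < length W \<and> ok (W ! r ! i)) \<longrightarrow>
           i \<le> pv i W \<and> pv i W < length W \<and> ok (W ! pv i W ! i))"

definition first_pivot :: "nat \<Rightarrow> complex list list \<Rightarrow> nat" where
  "first_pivot i W = (LEAST r. i \<le> r \<and> r < length W \<and> W ! r ! i \<noteq> 0)"

definition mat_invM :: "nat \<Rightarrow> complex list list \<Rightarrow> complex list list comp" where
  "mat_invM s X = do {
    W \<leftarrow> return (map (\<lambda>i. X ! i @ map (\<lambda>j. if i = j then 1 else 0) [0..<s]) [0..<s]);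
    V \<leftarrow> gauss_jordan (\<lambda>x. divM 1 x) mulM subM first_pivot s W;
    return (map (drop s) V) }"


section \<open>Scalar series\<close>

definition pad :: "nat \<Rightarrow> complex list \<Rightarrow> complex list" where
  "pad L xs = xs @ replicate (L - length xs) 0"

text \<open>Radix-2 FFT of length $2^k$ with kernel $\exp(2\pi i \sigma jn/2^k)$, \<open>\<sigma> = \<plusminus>1\<close>.
  The primitive root of unity of each length is a constant of the program; its powers, the twiddle
  factors, are computed and charged.\<close>

primrec fft :: "real \<Rightarrow> nat \<Rightarrow> complex list \<Rightarrow> complex list comp" where
  "fft \<sigma> 0 xs = return xs"
| "fft \<sigma> (Suc k) xs = do {
    es \<leftarrow> fft \<sigma> k (map (\<lambda>j. xs ! (2 * j)) [0..<2 ^ k]);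
    os \<leftarrow> fft \<sigma> k (map (\<lambda>j. xs ! (2 * j + 1)) [0..<2 ^ k]);
    tw \<leftarrow> loopM (\<lambda>_ ws. do { w \<leftarrow> mulM (last ws) (cis (\<sigma> * 2 * pi / 2 ^ Suc k)); return (ws @ [w]) })
           [1..<2 ^ k] [1];
    ps \<leftarrow> mapM (\<lambda>j. mulM (tw ! j) (os ! j)) [0..<2 ^ k];
    us \<leftarrow> mapM (\<lambda>j. addM (es ! j) (ps ! j)) [0..<2 ^ k];
    vs \<leftarrow> mapM (\<lambda>j. subM (es ! j) (ps ! j)) [0..<2 ^ k];
    return (us @ vs) }"

definition padded_fft :: "nat \<Rightarrow> complex list \<Rightarrow> complex list comp" where
  "padded_fft k xs = do { ys \<leftarrow> return (pad (2 ^ k) xs); fft (- 1) k ys }"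

definition inverse_fft :: "nat \<Rightarrow> complex list \<Rightarrow> complex list comp" where
  "inverse_fft k xs = do {
    ys \<leftarrow> fft 1 k xs;
    c \<leftarrow> divM 1 (2 ^ k);
    mapM (\<lambda>y. mulM c y) ys }"

text \<open>The exponent of the least power of two that is at least $2m-1$.\<close>

definition fft_exp :: "nat \<Rightarrow> nat" where
  "fft_exp m = ceillog2 (2 * m - 1)"

text \<open>Product modulo $x^m$ of two series with at most \<^term>\<open>m\<close> given coefficients.\<close>

definition series_mulM :: "nat \<Rightarrow> complex list \<Rightarrow> complex list \<Rightarrow> complex list comp" where
  "series_mulM m xs ys = do {
    fx \<leftarrow> padded_fft (fft_exp m) xs;
    fy \<leftarrow> padded_fft (fft_exp m) ys;
    fz \<leftarrow> mapM (\<lambda>j. mulM (fx ! j) (fy ! j)) [0..<2 ^ fft_exp m];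
    zs \<leftarrow> inverse_fft (fft_exp m) fz;
    return (take m zs) }"

definition series_subM :: "nat \<Rightarrow> complex list \<Rightarrow> complex list \<Rightarrow> complex list comp" where
  "series_subM m xs ys = mapM (\<lambda>k. subM (xs ! k) (ys ! k)) [0..<m]"

text \<open>Scalar Newton iteration $b \mapsto b(2 - ab)$; the precision doubles from $2^r$ to
  $2^{r+1}$ in pass \<^term>\<open>r\<close> and is cut off at \<^term>\<open>N\<close> in the last pass.\<close>

definition series_invM :: "nat \<Rightarrow> complex list \<Rightarrow> complex list comp" where
  "series_invM N a = do {
    c \<leftarrow> divM 1 (a ! 0);
    loopM (\<lambda>r b. let m = min (2 ^ Suc r) N in do {
      t \<leftarrow> series_mulM m (take m a) b;
      u \<leftarrow> mapM (\<lambda>k. subM (if k = 0 then 2 else 0) (t ! k)) [0..<m];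
      series_mulM m b u }) [0..<ceillog2 N] [c] }"


section \<open>Matrix series\<close>

text \<open>A matrix series is the list of its coefficient matrices. Product modulo $x^m$ of two
  matrix series with at most \<^term>\<open>m\<close> given coefficients.\<close>

definition mat_series_mulM ::
  "nat \<Rightarrow> nat \<Rightarrow> complex list list list \<Rightarrow> complex list list list \<Rightarrow> complex list list list comp" where
  "mat_series_mulM s m X Y = do {
    fX \<leftarrow> mapM (\<lambda>i. mapM (\<lambda>j. padded_fft (fft_exp m) (map (\<lambda>M. M ! i ! j) X)) [0..<s]) [0..<s];
    fY \<leftarrow> mapM (\<lambda>i. mapM (\<lambda>j. padded_fft (fft_exp m) (map (\<lambda>M. M ! i ! j) Y)) [0..<s]) [0..<s];
    fZ \<leftarrow> mapM (\<lambda>f. mat_mulM s (map (map (\<lambda>xs. xs ! f)) fX) (map (map (\<lambda>xs. xs ! f)) fY))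
           [0..<2 ^ fft_exp m];
    Z \<leftarrow> mapM (\<lambda>i. mapM (\<lambda>j. do {
           zs \<leftarrow> inverse_fft (fft_exp m) (map (\<lambda>M. M ! i ! j) fZ);
           return (take m zs) }) [0..<s]) [0..<s];
    return (map (\<lambda>k. map (map (\<lambda>zs. zs ! k)) Z) [0..<m]) }"


section \<open>The three inversion methods\<close>

text \<open>The input of each method is the list \<^term>\<open>coeffs N A\<close> of the first \<^term>\<open>N\<close>
  coefficients.\<close>

definition recursive_inverse ::
  "nat \<Rightarrow> nat \<Rightarrow> complex list list list \<Rightarrow> complex list list list comp" where
  "recursive_inverse s N A = do {
    A0inv \<leftarrow> mat_invM s (A ! 0);
    loopM (\<lambda>k B. do {
      S \<leftarrow> loopM (\<lambda>l acc. do {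
             T \<leftarrow> mat_mulM s (B ! l) (A ! (k - l));
             U \<leftarrow> mat_mulM s T A0inv;
             mat_addM s acc U }) [0..<k] (replicate s (replicate s 0));
      Bk \<leftarrow> mat_negM s S;
      return (B @ [Bk]) }) [1..<N] [A0inv] }"

definition newton_inverse ::
  "nat \<Rightarrow> nat \<Rightarrow> complex list list list \<Rightarrow> complex list list list comp" where
  "newton_inverse s N A = do {
    A0inv \<leftarrow> mat_invM s (A ! 0);
    loopM (\<lambda>r B. let m = min (2 ^ Suc r) N in do {
      T \<leftarrow> mat_series_mulM s m (take m A) B;
      U \<leftarrow> mapM (\<lambda>k. mapM (\<lambda>i. mapM (\<lambda>j.
             subM (if k = 0 \<and> i = j then 2 else 0) (T ! k ! i ! j)) [0..<s]) [0..<s]) [0..<m];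
      mat_series_mulM s m B U }) [0..<ceillog2 N] [A0inv] }"

text \<open>An element of the truncated power series ring modulo $x^N$ is the list of its \<^term>\<open>N\<close>
  coefficients.\<close>

definition gauss_jordan_inverse ::
  "(nat \<Rightarrow> complex list list list \<Rightarrow> nat) \<Rightarrow> nat \<Rightarrow> nat \<Rightarrow> complex list list list \<Rightarrow>
   complex list list list comp" where
  "gauss_jordan_inverse pv s N A = do {
    W \<leftarrow> return (map (\<lambda>i.
           map (\<lambda>j. map (\<lambda>M. M ! i ! j) A) [0..<s] @
           map (\<lambda>j. pad N [if i = j then 1 else 0]) [0..<s]) [0..<s]);
    V \<leftarrow> gauss_jordan (series_invM N) (series_mulM N) (series_subM N) pv s W;
    return (map (\<lambda>k. map (\<lambda>row. map (\<lambda>j. row ! (s + j) ! k) [0..<s]) V) [0..<N]) }"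

definition storage :: "complex list list list \<Rightarrow> 'a comp \<Rightarrow> nat" where
  "storage input c = cells input + peak c"

end

theory Submission
  imports
    "HOL-Computational_Algebra.Polynomial_FPS"
    "Jordan_Normal_Form.Determinant"
    Defs
begin

text \<open>A matrix sequence is a square matrix over the formal power series and convolution is the matrix
  product, so the convolution inverse is the inverse over that ring; it exists because the determinant
  has a nonzero constant coefficient. If \<open>B\<close> is the inverse of \<open>F\<close> and \<open>b = B - D\<close> agrees with \<open>B\<close>
  modulo $x^n$, then $b (2 - F b) = B - D F D$ agrees with \<open>B\<close> modulo $x^{2n}$. In Gauss--Jordan
  elimination the left block is always the right block times the input, so when the left block has
  become the identity the right block is the inverse.

  The FFT of a padded series is the evaluation of a polynomial at the roots of unity; its length is at
  most \<open>4 * m\<close> for precision \<open>m\<close>. As the precision doubles in each Newton pass, the costs of the passes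
  form a geometric sum dominated by the last one. Storage stays linear because the two
  half-length transforms of an FFT run one after the other and reuse their working space.\<close>

section \<open>Cost calculus\<close>

text \<open>\<open>computes\<close> fixes the value of a program but only bounds its operations and
  storage, so bounds of parts compose by sums and maxima, and a program is weighed by one final
  comparison. Truncated series are not put into a quotient ring: correctness is a congruence between
  full series, so the exact inverse is the target of every pass. The elimination admits any pivot
  rule, which makes the result of a pass unpredictable; it is therefore followed by an invariant in
  place of a closed form. It is analysed once, over an abstract arithmetic: modulo \<open>x\<close>
  this yields the scalar inverse of the constant coefficient that the other two methods start from,
  modulo \<open>x^N\<close> the series method. \<open>fft_exp N\<close> stands for the logarithm in
  all cost bounds and is replaced by \<open>3 * log 2 N\<close> only at the end. The constants are
  generous; the largest one that results is \<open>7 * (192 * 3 + 104) = 4760\<close>, below the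
  common constant 6000.\<close>

definition computes :: "'a comp \<Rightarrow> 'a \<Rightarrow> nat \<Rightarrow> nat \<Rightarrow> bool" where
  "computes c x t p \<longleftrightarrow> result c = x \<and> ops c \<le> t \<and> peak c \<le> p"

lemma computes_mono:
  "computes c x t p \<Longrightarrow> t \<le> t' \<Longrightarrow> p \<le> p' \<Longrightarrow> computes c x t' p'"
  by (simp add: computes_def)

lemma computes_return: "cells x \<le> p \<Longrightarrow> computes (return x) x t p"
  by (simp add: computes_def return_def)

lemma computes_arith:
  "computes (addM x y) (x + y) 1 1" "computes (subM x y) (x - y) 1 1"
  "computes (mulM x y) (x * y) 1 1" "computes (divM x y) (x / y) 1 1"
  by (simp_all add: computes_def addM_def subM_def mulM_def divM_def)

lemma computes_bind:
  assumes "computes c x t1 p1" "computes (f x) y t2 p2"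
    and "p1 \<le> p" "cells x + p2 \<le> p" "t1 + t2 \<le> t"
  shows "computes (bind_comp c f) y t p"
  using assms by (auto simp: computes_def bind_comp_def Let_def)

text \<open>Here the bounds of the conclusion are synthesized from those of the parts. Repeated
  application walks through a whole \<open>do\<close> block with schematic bounds, and
  \<open>computes_mono\<close> leaves only the two final comparisons; \<open>computes_bind\<close>
  instead checks against bounds known in advance.\<close>

lemma computes_bind_max:
  assumes "computes c x t1 p1" "computes (f x) y t2 p2"
  shows "computes (bind_comp c f) y (t1 + t2) (max p1 (cells x + p2))"
  using assms by (auto simp: computes_def bind_comp_def Let_def)

lemma cells_Nil [simp]: "cells [] = 0"
  and cells_Cons [simp]: "cells (x # xs) = cells x + cells xs"
  and cells_append [simp]: "cells (xs @ ys) = cells xs + cells ys"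
  by (simp_all add: cells_list_def)

lemma cells_complex_list [simp]: "cells (xs :: complex list) = length xs"
  by (induction xs) (auto simp: cells_complex_def)

lemma cells_complex_eq [simp]: "cells (z :: complex) = 1"
  by (simp add: cells_complex_def)

lemma cells_list_le:
  "(\<And>x. x \<in> set xs \<Longrightarrow> cells x \<le> n) \<Longrightarrow> cells xs \<le> length xs * n"
  by (induction xs) (auto intro: add_mono)

lemma cells_map_le:
  "(\<And>i. i \<in> set js \<Longrightarrow> cells (g i) \<le> n) \<Longrightarrow> cells (map g js) \<le> length js * n"
  using cells_list_le[of "map g js" n] by auto

text \<open>The factor 2 is the price of building the list functionally: when \<open>y # ys\<close>
  is returned, \<open>y\<close> and \<open>ys\<close> are still bound, so each entry is held twice.
  The working space \<open>p\<close> counts once because one call releases it before the next call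
  starts.\<close>

lemma computes_mapM:
  assumes "\<And>i. i \<in> set js \<Longrightarrow> computes (f i) (g i) t p"
    and "\<And>i. i \<in> set js \<Longrightarrow> cells (g i) \<le> n"
  shows "computes (mapM f js) (map g js) (length js * t) (2 * length js * n + p)"
  using assms
proof (induction js)
  case Nil
  then show ?case by (simp add: computes_return)
next
  case (Cons i js)
  have le: "cells (map g js) \<le> length js * n"
    using Cons.prems(2) by (intro cells_map_le) simp
  have IH: "computes (mapM f js) (map g js) (length js * t) (2 * length js * n + p)"
    using Cons by simp
  have last: "computes (return (g i # map g js)) (g i # map g js) 0 (Suc (length js) * n)"
    using le Cons.prems(2)[of i] by (intro computes_return) simp
  have rest: "computes (mapM f js \<bind> (\<lambda>ys. return (g i # ys))) (g i # map g js)
      (length js * t) (2 * length js * n + p + n)"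
    by (rule computes_bind[OF IH], rule last) (use le in \<open>auto simp: algebra_simps\<close>)
  have first: "computes (f i) (g i) t p"
    using Cons.prems(1) by simp
  have "computes (mapM f (i # js)) (g i # map g js)
      (length (i # js) * t) (2 * length (i # js) * n + p)"
    unfolding mapM.simps
    by (rule computes_bind[OF first], rule rest) (use Cons.prems(2)[of i] in auto)
  then show ?case by simp
qed

text \<open>The state is described by a predicate because after an elimination pass it depends on
  the rows that the pivot rule picked. The costs \<open>t i\<close> may vary, as the geometric sums
  of Newton iteration require, while storage is one state plus one pass whatever the number of
  passes.\<close>

lemma computes_loopM_inv:
  assumes "a \<le> b" "Inv a x"
    and step: "\<And>i x. a \<le> i \<Longrightarrow> i < b \<Longrightarrow> Inv i x \<Longrightarrow>
      \<exists>y. Inv (Suc i) y \<and> computes (f i x) y (t i) q"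
    and cells: "\<And>i x. a \<le> i \<Longrightarrow> i \<le> b \<Longrightarrow> Inv i x \<Longrightarrow> cells x \<le> n"
  shows "\<exists>y. Inv b y \<and> computes (loopM f [a..<b] x) y (\<Sum>i=a..<b. t i) (n + q)"
  using assms
proof (induction "b - a" arbitrary: a x)
  case 0
  have ab: "a = b" using 0 by simp
  then have "cells x \<le> n" using 0(5)[of a x] 0(3) by simp
  then have "computes (loopM f [a..<b] x) x (\<Sum>i=a..<b. t i) (n + q)"
    using ab by (simp add: computes_return)
  with 0(3) ab show ?case by auto
next
  case (Suc d)
  then have ab: "a < b" by simp
  obtain y where y: "Inv (Suc a) y" "computes (f a x) y (t a) q"
    using Suc.prems(2,3) ab by blast
  obtain z where z: "Inv b z" "computes (loopM f [Suc a..<b] y) z (\<Sum>i=Suc a..<b. t i) (n + q)"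
  proof (atomize_elim, rule Suc.hyps(1))
    show "d = b - Suc a" "Suc a \<le> b" using Suc.hyps(2) ab by simp_all
    show "Inv (Suc a) y" by (rule y(1))
  next
    fix i x assume "Suc a \<le> i" "i < b" "Inv i x"
    then show "\<exists>y. Inv (Suc i) y \<and> computes (f i x) y (t i) q"
      by (intro Suc.prems(3)) simp_all
  next
    fix i x assume "Suc a \<le> i" "i \<le> b" "Inv i x"
    then show "cells x \<le> n"
      by (intro Suc.prems(4)[of i]) simp_all
  qed
  have "cells x \<le> n" using Suc.prems(1,2) Suc.prems(4)[of a] by simp
  then have "computes (loopM f [a..<b] x) z (\<Sum>i=a..<b. t i) (n + q)"
    using y(2) z(2) ab
    by (simp add: upt_conv_Cons computes_def Let_def sum.atLeast_Suc_lessThan)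
  with z(1) show ?case by blast
qed

lemma computes_loopM:
  assumes "a \<le> b"
    and "\<And>i. a \<le> i \<Longrightarrow> i < b \<Longrightarrow> computes (f i (y i)) (y (Suc i)) (t i) q"
    and "\<And>i. a \<le> i \<Longrightarrow> i \<le> b \<Longrightarrow> cells (y i) \<le> n"
  shows "computes (loopM f [a..<b] (y a)) (y b) (\<Sum>i=a..<b. t i) (n + q)"
  using computes_loopM_inv[of a b "\<lambda>i x. x = y i" "y a" f t q n] assms by auto

section \<open>The fast Fourier transform\<close>

definition fft_root :: "real \<Rightarrow> nat \<Rightarrow> complex" where
  "fft_root \<sigma> k = cis (\<sigma> * 2 * pi / 2 ^ k)"

definition dft :: "real \<Rightarrow> nat \<Rightarrow> complex list \<Rightarrow> complex list" where
  "dft \<sigma> k xs = map (\<lambda>n. \<Sum>j<2 ^ k. xs ! j * fft_root \<sigma> k ^ (j * n)) [0..<2 ^ k]"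

lemma fft_root_Suc_square: "fft_root \<sigma> (Suc k) ^ 2 = fft_root \<sigma> k"
  by (simp add: fft_root_def DeMoivre field_simps)

lemma fft_root_half:
  assumes "\<sigma> \<in> {1, -1}"
  shows "fft_root \<sigma> (Suc k) ^ 2 ^ k = -1"
proof -
  have "fft_root \<sigma> (Suc k) ^ 2 ^ k = cis (\<sigma> * pi)"
    by (simp add: fft_root_def DeMoivre)
  with assms show ?thesis by (auto simp: complex_eq_iff)
qed

lemma fft_root_full:
  assumes "\<sigma> \<in> {1, -1}"
  shows "fft_root \<sigma> k ^ 2 ^ k = 1"
proof -
  have "fft_root \<sigma> k ^ 2 ^ k = cis (\<sigma> * (2 * pi))"
    by (simp add: fft_root_def DeMoivre mult.assoc)
  with assms show ?thesis by (auto simp: complex_eq_iff)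
qed

lemma sum_even_odd:
  fixes f :: "nat \<Rightarrow> 'a::comm_monoid_add"
  shows "(\<Sum>j<2 * L. f j) = (\<Sum>j<L. f (2 * j)) + (\<Sum>j<L. f (2 * j + 1))"
  by (induction L) (simp_all add: algebra_simps)

text \<open>Decimation in time: the square of the root for length \<open>2 ^ Suc k\<close> is the
  root for length \<open>2 ^ k\<close>, so the even and the odd positions each give a sum of half
  the length, the odd one with a factor in front.\<close>

lemma dft_sum_Suc:
  "(\<Sum>j<2 ^ Suc k. xs ! j * fft_root \<sigma> (Suc k) ^ (j * n)) =
   (\<Sum>j<2 ^ k. xs ! (2 * j) * fft_root \<sigma> k ^ (j * n)) +
   fft_root \<sigma> (Suc k) ^ n * (\<Sum>j<2 ^ k. xs ! (2 * j + 1) * fft_root \<sigma> k ^ (j * n))"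
proof -
  have 1: "fft_root \<sigma> (Suc k) ^ (2 * j * n) = fft_root \<sigma> k ^ (j * n)" for j
    by (metis mult.assoc power_mult fft_root_Suc_square)
  then have 2: "fft_root \<sigma> (Suc k) ^ ((2 * j + 1) * n) = fft_root \<sigma> (Suc k) ^ n * fft_root \<sigma> k ^ (j * n)" for j
    by (metis add_mult_distrib mult_1 power_add mult.commute)
  show ?thesis
    unfolding power_Suc sum_even_odd 1 2 sum_distrib_left by (simp add: ac_simps)
qed

text \<open>The butterfly. Raising the frequency by \<open>2 ^ k\<close> leaves both half-length
  transforms unchanged, because the \<open>2 ^ k\<close>-th power of their root is 1, and changes
  the sign of the twiddle factor, because that power of the root for the doubled length is
  -1.\<close>

lemma dft_Suc:
  assumes "\<sigma> \<in> {1, -1}"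
  defines "E \<equiv> \<lambda>k xs. dft \<sigma> k (map (\<lambda>j. xs ! (2 * j)) [0..<2 ^ k])"
    and "D \<equiv> \<lambda>k xs. dft \<sigma> k (map (\<lambda>j. xs ! (2 * j + 1)) [0..<2 ^ k])"
  shows "dft \<sigma> (Suc k) xs =
    map (\<lambda>n. E k xs ! n + fft_root \<sigma> (Suc k) ^ n * D k xs ! n) [0..<2 ^ k] @
    map (\<lambda>n. E k xs ! n - fft_root \<sigma> (Suc k) ^ n * D k xs ! n) [0..<2 ^ k]"
proof -
  let ?F = "\<lambda>n. \<Sum>j<2 ^ Suc k. xs ! j * fft_root \<sigma> (Suc k) ^ (j * n)"
  have period: "fft_root \<sigma> k ^ (j * (n + 2 ^ k)) = fft_root \<sigma> k ^ (j * n)" for j n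
  proof -
    have "fft_root \<sigma> k ^ (j * (n + 2 ^ k)) = fft_root \<sigma> k ^ (j * n) * (fft_root \<sigma> k ^ 2 ^ k) ^ j"
      by (simp add: algebra_simps power_add flip: power_mult)
    with fft_root_full[OF assms(1)] show ?thesis by simp
  qed
  have half: "fft_root \<sigma> (Suc k) ^ (n + 2 ^ k) = - (fft_root \<sigma> (Suc k) ^ n)" for n
    using fft_root_half[OF assms(1)] by (simp add: power_add)
  have E: "(\<Sum>j<2 ^ k. xs ! (2 * j) * fft_root \<sigma> k ^ (j * n)) = E k xs ! n" if "n < 2 ^ k" for n
    using that by (simp add: E_def dft_def)
  have D: "(\<Sum>j<2 ^ k. xs ! (2 * j + 1) * fft_root \<sigma> k ^ (j * n)) = D k xs ! n" if "n < 2 ^ k" for n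
    using that by (simp add: D_def dft_def)
  have lo: "?F n = E k xs ! n + fft_root \<sigma> (Suc k) ^ n * D k xs ! n" if "n < 2 ^ k" for n
    by (simp only: dft_sum_Suc E[OF that] D[OF that])
  have hi: "?F (n + 2 ^ k) = E k xs ! n - fft_root \<sigma> (Suc k) ^ n * D k xs ! n" if "n < 2 ^ k" for n
    by (simp only: dft_sum_Suc period half E[OF that] D[OF that] mult_minus_left add_uminus_conv_diff)
  have "[0..<2 ^ Suc k] = [0..<2 ^ k] @ map (\<lambda>n. n + 2 ^ k) [0..<2 ^ k]"
    using upt_add_eq_append[of 0 "2 ^ k" "2 ^ k :: nat"] by (simp only: map_add_upt power_Suc mult_2)
  then have "dft \<sigma> (Suc k) xs = map ?F [0..<2 ^ k] @ map (\<lambda>n. ?F (n + 2 ^ k)) [0..<2 ^ k]"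
    by (simp add: dft_def del: power_Suc)
  with lo hi show ?thesis by simp
qed

lemma length_dft [simp]: "length (dft \<sigma> k xs) = 2 ^ k"
  by (simp add: dft_def)

text \<open>The operation count solves \<open>T (k + 1) = 2 * T k + 4 * 2 ^ k\<close>: a level
  spends at most \<open>2 ^ k\<close> operations on each of twiddle factors, products, sums and
  differences.\<close>

lemma computes_fft:
  assumes "\<sigma> \<in> {1, -1}"
  shows "length xs = 2 ^ k \<Longrightarrow> computes (fft \<sigma> k xs) (dft \<sigma> k xs) (2 * k * 2 ^ k) (8 * 2 ^ k)"
proof (induction k arbitrary: xs)
  case 0
  then obtain x where "xs = [x]" by (auto simp: length_Suc_conv)
  then show ?case by (auto simp: dft_def intro!: computes_return)
next
  case (Suc k)
  define L :: nat where "L = 2 ^ k"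
  have L: "L \<ge> 1" by (simp add: L_def)
  let ?w = "fft_root \<sigma> (Suc k)"
  define es where "es = dft \<sigma> k (map (\<lambda>j. xs ! (2 * j)) [0..<2 ^ k])"
  define os where "os = dft \<sigma> k (map (\<lambda>j. xs ! (2 * j + 1)) [0..<2 ^ k])"
  define tw where "tw = map (\<lambda>j. ?w ^ j) [0..<L]"
  define ps where "ps = map (\<lambda>j. tw ! j * os ! j) [0..<L]"
  define us where "us = map (\<lambda>j. es ! j + ps ! j) [0..<L]"
  define vs where "vs = map (\<lambda>j. es ! j - ps ! j) [0..<L]"
  have len: "length es = L" "length os = L" "length tw = L" "length ps = L" "length us = L" "length vs = L"
    by (simp_all add: es_def os_def tw_def ps_def us_def vs_def L_def)
  have res: "dft \<sigma> (Suc k) xs = us @ vs"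
    unfolding dft_Suc[OF assms]
    by (simp add: us_def vs_def ps_def tw_def es_def os_def L_def)
  have c_es: "computes (fft \<sigma> k (map (\<lambda>j. xs ! (2 * j)) [0..<2 ^ k])) es (2 * k * L) (8 * L)"
    unfolding es_def L_def by (rule Suc.IH) simp
  have c_os: "computes (fft \<sigma> k (map (\<lambda>j. xs ! (2 * j + 1)) [0..<2 ^ k])) os (2 * k * L) (8 * L)"
    unfolding os_def L_def by (rule Suc.IH) simp
  \<comment> \<open>The loop starts with power 0 in place, so pass \<open>i\<close> appends power
    \<open>i\<close> and \<open>L - 1\<close> multiplications suffice.\<close>
  have "computes (loopM (\<lambda>_ ws. do { w \<leftarrow> mulM (last ws) ?w; return (ws @ [w]) }) [1..<L]
      ((\<lambda>i. map (\<lambda>j. ?w ^ j) [0..<i]) 1)) tw (\<Sum>i=1..<L. 1) (L + (2 + L))"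
    unfolding tw_def
  proof (rule computes_loopM[where y = "\<lambda>i. map (\<lambda>j. ?w ^ j) [0..<i]"])
    fix i assume i: "1 \<le> i" "i < L"
    then have "last (map (\<lambda>j. ?w ^ j) [0..<i]) * ?w = ?w ^ i"
      by (simp add: last_map flip: power_Suc2)
    moreover have "computes (mulM (last (map (\<lambda>j. ?w ^ j) [0..<i])) ?w \<bind>
        (\<lambda>w. return (map (\<lambda>j. ?w ^ j) [0..<i] @ [w])))
        (map (\<lambda>j. ?w ^ j) [0..<i] @ [last (map (\<lambda>j. ?w ^ j) [0..<i]) * ?w]) 1 (2 + L)"
      by (rule computes_mono, (rule computes_bind_max computes_arith computes_return[OF order_refl])+)
        (use i in simp_all)
    ultimately show "computes (mulM (last (map (\<lambda>j. ?w ^ j) [0..<i])) ?w \<bind>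
        (\<lambda>w. return (map (\<lambda>j. ?w ^ j) [0..<i] @ [w]))) (map (\<lambda>j. ?w ^ j) [0..<Suc i]) 1 (2 + L)"
      by simp
  qed (use L in auto)
  then have c_tw: "computes (loopM (\<lambda>_ ws. do { w \<leftarrow> mulM (last ws) ?w; return (ws @ [w]) })
      [1..<L] [1]) tw L (2 * L + 2)"
    by (auto elim!: computes_mono)
  have c_ps: "computes (mapM (\<lambda>j. mulM (tw ! j) (os ! j)) [0..<L]) ps L (2 * L + 1)"
    unfolding ps_def using computes_mapM[OF computes_arith(3), of "[0..<L]" _ _ 1] by simp
  have c_us: "computes (mapM (\<lambda>j. addM (es ! j) (ps ! j)) [0..<L]) us L (2 * L + 1)"
    unfolding us_def using computes_mapM[OF computes_arith(1), of "[0..<L]" _ _ 1] by simp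
  have c_vs: "computes (mapM (\<lambda>j. subM (es ! j) (ps ! j)) [0..<L]) vs L (2 * L + 1)"
    unfolding vs_def using computes_mapM[OF computes_arith(2), of "[0..<L]" _ _ 1] by simp
  have c_ret: "computes (return (us @ vs)) (us @ vs) 0 (2 * L)"
    by (rule computes_return) (simp add: len)
  \<comment> \<open>The largest demand is \<open>9 * L\<close>, while the second half-length
    transform runs next to \<open>es\<close>. The six intermediate lists together with the result
    take \<open>8 * L\<close>.\<close>
  have "computes (fft \<sigma> (Suc k) xs) (us @ vs) (4 * k * L + 4 * L) (16 * L)"
    unfolding fft.simps fft_root_def[symmetric] L_def[symmetric]
    by (rule computes_mono,
      (rule computes_bind_max c_es[unfolded L_def[symmetric]] c_os[unfolded L_def[symmetric]] c_tw c_ps c_us c_vs c_ret)+)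
      (use L in \<open>simp_all add: len nat_add_max_right\<close>)
  then show ?case
    unfolding res by (simp add: L_def algebra_simps)
qed

section \<open>Evaluation and interpolation at the roots of unity\<close>

lemma poly_as_sum_lessThan:
  fixes p :: "'a::comm_semiring_1 poly"
  assumes "degree p < L"
  shows "poly p z = (\<Sum>j<L. coeff p j * z ^ j)"
proof -
  have "poly p z = (\<Sum>j\<le>degree p. coeff p j * z ^ j)"
    by (rule poly_altdef)
  also have "\<dots> = (\<Sum>j<L. coeff p j * z ^ j)"
    by (rule sum.mono_neutral_left) (use assms in \<open>auto simp: coeff_eq_0\<close>)
  finally show ?thesis .
qed

lemma dft_coeffs:
  assumes "degree p < 2 ^ k"
  shows "dft \<sigma> k (map (coeff p) [0..<2 ^ k]) = map (\<lambda>n. poly p (fft_root \<sigma> k ^ n)) [0..<2 ^ k]"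
  unfolding dft_def poly_as_sum_lessThan[OF assms] by (simp flip: power_mult add: mult.commute)

lemma pad_eq_coeffs: "length xs \<le> L \<Longrightarrow> pad L xs = map (coeff (Poly xs)) [0..<L]"
  by (rule nth_equalityI) (auto simp: pad_def nth_default_def nth_append)

lemma degree_Poly_less: "length xs \<le> m \<Longrightarrow> 0 < m \<Longrightarrow> degree (Poly xs) < m"
  by (rule degree_lessI) (auto simp: nth_default_def)

lemma computes_padded_fft:
  assumes "length xs \<le> 2 ^ k"
  shows "computes (padded_fft k xs)
    (map (\<lambda>n. poly (Poly xs) (fft_root (- 1) k ^ n)) [0..<2 ^ k]) (2 * k * 2 ^ k) (9 * 2 ^ k)"
proof -
  let ?P = "map (coeff (Poly xs)) [0..<2 ^ k]"
  have "computes (fft (- 1) k ?P) (dft (- 1) k ?P) (2 * k * 2 ^ k) (8 * 2 ^ k)"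
    by (rule computes_fft) simp_all
  then have fft: "computes (fft (- 1) k ?P)
      (map (\<lambda>n. poly (Poly xs) (fft_root (- 1) k ^ n)) [0..<2 ^ k]) (2 * k * 2 ^ k) (8 * 2 ^ k)"
    by (simp only: dft_coeffs[OF degree_Poly_less[OF assms]] zero_less_power zero_less_numeral)
  show ?thesis
    unfolding padded_fft_def pad_eq_coeffs[OF assms]
    by (rule computes_mono, (rule computes_bind_max computes_return[OF order_refl] fft)+) simp_all
qed

text \<open>The sum is geometric with ratio \<open>z\<close>. It vanishes off the diagonal since
  \<open>z ^ 2 ^ k = 1\<close>, while \<open>z \<noteq> 1\<close> because the powers of a primitive
  root with exponents below \<open>2 ^ k\<close> are distinct.\<close>

lemma fft_root_orthogonal:
  assumes "m < 2 ^ k" "j < 2 ^ k"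
  shows "(\<Sum>n<2 ^ k. fft_root (- 1) k ^ (n * j) * fft_root 1 k ^ (n * m)) = (if j = m then 2 ^ k else 0)"
proof -
  let ?w = "fft_root 1 k"
  have inv: "fft_root (- 1) k * ?w = 1"
    by (simp add: fft_root_def cis_mult)
  have w0: "?w \<noteq> 0" using inv by auto
  define z where "z = fft_root (- 1) k ^ j * ?w ^ m"
  have z: "(\<Sum>n<2 ^ k. fft_root (- 1) k ^ (n * j) * ?w ^ (n * m)) = (\<Sum>n<2 ^ k. z ^ n)"
    by (simp add: z_def power_mult_distrib mult.commute flip: power_mult)
  show ?thesis
  proof (cases "j = m")
    case True
    then have "z = 1" using inv by (simp add: z_def flip: power_mult_distrib)
    with True z show ?thesis by simp
  next
    case False
    have cis: "?w ^ n = cis (2 * pi * real n / real (2 ^ k))" for n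
      by (simp add: fft_root_def DeMoivre mult.commute)
    have "inj_on (\<lambda>n. cis (2 * pi * real n / real (2 ^ k))) {..<2 ^ k}"
      using bij_betw_roots_unity[of "2 ^ k"] by (simp only: bij_betw_def) simp
    with assms False have ne: "?w ^ m \<noteq> ?w ^ j"
      by (auto simp: cis inj_on_def)
    have "z * ?w ^ j = ?w ^ m"
      using inv by (simp add: z_def algebra_simps flip: power_mult_distrib)
    with ne have z1: "z \<noteq> 1" by auto
    have "z ^ 2 ^ k = (fft_root (- 1) k ^ 2 ^ k) ^ j * (?w ^ 2 ^ k) ^ m"
      by (simp add: z_def power_mult_distrib mult.commute flip: power_mult)
    then have "z ^ 2 ^ k = 1" by (simp add: fft_root_full)
    with z1 z False show ?thesis by (simp add: sum_gp_strict)
  qed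
qed

lemma dft_inverse:
  assumes "length xs = 2 ^ k"
  shows "map (\<lambda>y. 1 / 2 ^ k * y) (dft 1 k (dft (- 1) k xs)) = xs"
proof (rule nth_equalityI)
  fix m assume "m < length (map (\<lambda>y. 1 / 2 ^ k * y) (dft 1 k (dft (- 1) k xs)))"
  then have m: "m < 2 ^ k" by simp
  have "dft 1 k (dft (- 1) k xs) ! m =
      (\<Sum>n<2 ^ k. (\<Sum>j<2 ^ k. xs ! j * fft_root (- 1) k ^ (j * n)) * fft_root 1 k ^ (n * m))"
    using m by (simp add: dft_def)
  also have "\<dots> = (\<Sum>j<2 ^ k. xs ! j *
      (\<Sum>n<2 ^ k. fft_root (- 1) k ^ (n * j) * fft_root 1 k ^ (n * m)))"
    unfolding sum_distrib_right sum_distrib_left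
    by (subst sum.swap) (simp add: mult_ac)
  also have "\<dots> = (\<Sum>j<2 ^ k. xs ! j * (if j = m then 2 ^ k else 0))"
    by (intro sum.cong refl arg_cong2[where f = "(*)"] fft_root_orthogonal) (use m in auto)
  also have "\<dots> = xs ! m * 2 ^ k"
    using m by (simp add: if_distrib cong: if_cong)
  finally show "map (\<lambda>y. 1 / 2 ^ k * y) (dft 1 k (dft (- 1) k xs)) ! m = xs ! m"
    using m by simp
qed (simp add: assms)

text \<open>Stated as interpolation: the input is a list of values of \<open>p\<close>, the form in
  which pointwise products arrive, and the degree bound makes the \<open>2 ^ k\<close> values
  determine \<open>p\<close>.\<close>

lemma computes_inverse_fft:
  assumes "degree p < 2 ^ k"
  shows "computes (inverse_fft k (map (\<lambda>n. poly p (fft_root (- 1) k ^ n)) [0..<2 ^ k]))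
    (map (coeff p) [0..<2 ^ k]) (2 * k * 2 ^ k + 2 ^ k + 1) (8 * 2 ^ k)"
proof -
  define xs where "xs = map (coeff p) [0..<2 ^ k]"
  have len: "length xs = 2 ^ k" by (simp add: xs_def)
  have ys: "computes (fft 1 k (dft (- 1) k xs)) (dft 1 k (dft (- 1) k xs)) (2 * k * 2 ^ k) (8 * 2 ^ k)"
    by (rule computes_fft) simp_all
  \<comment> \<open>The transformed list, the factor \<open>c\<close> and the scaling hold at most
    \<open>3 * 2 ^ k + 2\<close> numbers; this inequality fits them into
    \<open>8 * 2 ^ k\<close>.\<close>
  have le5: "2 \<le> 5 * (2 :: nat) ^ k" by (induction k) auto
  have zs: "computes (mapM (mulM c) ys) (map (\<lambda>y. c * y) ys) (length ys) (2 * length ys + 1)" for c ys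
    using computes_mapM[OF computes_arith(3), of ys "\<lambda>_. c" "\<lambda>y. y" 1] by simp
  have "computes (inverse_fft k (dft (- 1) k xs))
      (map (\<lambda>y. 1 / 2 ^ k * y) (dft 1 k (dft (- 1) k xs))) (2 * k * 2 ^ k + 2 ^ k + 1) (8 * 2 ^ k)"
    unfolding inverse_fft_def
    by (rule computes_mono, (rule computes_bind_max ys computes_arith zs)+)
      (simp_all add: le5)
  then show ?thesis
    unfolding dft_inverse[OF len] unfolding xs_def dft_coeffs[OF assms] .
qed

section \<open>Truncated power series\<close>

no_notation vec_index (infixl "$" 100)
unbundle fps_syntax

definition series :: "'a::comm_semiring_0 list \<Rightarrow> 'a fps" where
  "series xs = fps_of_poly (Poly xs)"

definition prefix :: "nat \<Rightarrow> 'a::zero fps \<Rightarrow> 'a list" where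
  "prefix m f = map (fps_nth f) [0..<m]"

text \<open>Congruence modulo \<open>x^m\<close> is kept as a relation so that one series can be
  compared at all the precisions that occur during an iteration.\<close>

definition fps_cong :: "nat \<Rightarrow> 'a::zero fps \<Rightarrow> 'a fps \<Rightarrow> bool" where
  "fps_cong m f g \<longleftrightarrow> (\<forall>k<m. f $ k = g $ k)"

lemma series_nth: "series xs $ k = (if k < length xs then xs ! k else 0)"
  by (simp add: series_def nth_default_def)

lemma length_prefix [simp]: "length (prefix m f) = m"
  by (simp add: prefix_def)

lemma prefix_nth [simp]: "k < m \<Longrightarrow> prefix m f ! k = f $ k"
  by (simp add: prefix_def)

lemma prefix_eq_iff: "prefix m f = prefix m g \<longleftrightarrow> fps_cong m f g"
  by (auto simp: prefix_def fps_cong_def)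

lemma fps_cong_refl [simp]: "fps_cong m f f"
  and fps_cong_sym: "fps_cong m f g \<Longrightarrow> fps_cong m g f"
  and fps_cong_trans [trans]: "fps_cong m f g \<Longrightarrow> fps_cong m g h \<Longrightarrow> fps_cong m f h"
  by (simp_all add: fps_cong_def)

lemma fps_cong_series_prefix: "fps_cong m (series (prefix m f)) f"
  by (simp add: fps_cong_def series_nth)

lemma fps_cong_diff:
  fixes f :: "'a::ab_group_add fps"
  shows "fps_cong m f f' \<Longrightarrow> fps_cong m g g' \<Longrightarrow> fps_cong m (f - g) (f' - g')"
  by (simp add: fps_cong_def)

lemma fps_cong_mult:
  "fps_cong m f f' \<Longrightarrow> fps_cong m g g' \<Longrightarrow> fps_cong m (f * g) (f' * g')"
  by (auto simp: fps_cong_def fps_mult_nth intro!: sum.cong)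

lemma fps_cong_sum:
  "(\<And>i. i \<in> I \<Longrightarrow> fps_cong m (f i) (g i)) \<Longrightarrow> fps_cong m (sum f I) (sum g I)"
  by (auto simp: fps_cong_def fps_sum_nth intro!: sum.cong)

text \<open>Orders of vanishing add, which is the source of the doubling of precision: in each term
  of the Cauchy sum, either the index of \<open>f\<close> is below \<open>m\<close> or that of
  \<open>g\<close> is below \<open>n\<close>.\<close>

lemma fps_mult_nth_eq_0:
  fixes f g :: "'a::semiring_0 fps"
  assumes "fps_cong m f 0" "fps_cong n g 0" "k < m + n"
  shows "(f * g) $ k = 0"
  unfolding fps_mult_nth
proof (rule sum.neutral, rule ballI)
  fix i assume "i \<in> {0..k}"
  then show "f $ i * g $ (k - i) = 0"
    using assms by (cases "i < m") (auto simp: fps_cong_def)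
qed

section \<open>FFT length and products of truncated scalar series\<close>

lemma fft_exp_ge: "2 * m - 1 \<le> 2 ^ fft_exp m"
  unfolding fft_exp_def by (rule le_two_power_ceillog2)

lemma fft_exp_le: "1 \<le> m \<Longrightarrow> 2 ^ fft_exp m \<le> 4 * m"
  using two_power_ceillog2_gt[of "2 * m - 1"] by (simp add: fft_exp_def)

lemma fft_exp_mono: "m \<le> n \<Longrightarrow> fft_exp m \<le> fft_exp n"
  unfolding fft_exp_def by (intro ceillog2_mono) simp

text \<open>This excludes wrap-around: the full product has degree at most \<open>2 * m - 2\<close>,
  so the cyclic convolution of length \<open>2 ^ fft_exp m\<close> is the true product, and
  truncation to \<open>m\<close> coefficients may wait until the end.\<close>

lemma degree_Poly_mult_less:
  assumes "1 \<le> m" "length xs \<le> m" "length ys \<le> m"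
  shows "degree (Poly xs * Poly ys) < 2 ^ fft_exp m"
proof -
  have "degree (Poly xs * Poly ys) \<le> degree (Poly xs) + degree (Poly ys)"
    by (rule degree_mult_le)
  also have "\<dots> < 2 * m - 1"
    using degree_Poly_less[of xs m] degree_Poly_less[of ys m] assms by simp
  finally show ?thesis using fft_exp_ge[of m] by simp
qed

text \<open>Three transforms cost \<open>6 * k * 2 ^ k\<close>; pointwise products and scaling fit
  into \<open>3 * 2 ^ k\<close>. The peak occurs in the inverse transform, where three lists of
  length \<open>2 ^ k\<close> are held next to its own \<open>8 * 2 ^ k\<close>.\<close>

lemma computes_series_mulM_exp:
  fixes xs ys :: "complex list"
  assumes m: "1 \<le> m" and xs: "length xs \<le> m" and ys: "length ys \<le> m"
  defines "k \<equiv> fft_exp m"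
  shows "computes (series_mulM m xs ys) (prefix m (series xs * series ys))
    ((6 * k + 3) * 2 ^ k) (11 * 2 ^ k)"
proof -
  define L :: nat where "L = 2 ^ k"
  have mL: "m \<le> L" using fft_exp_ge[of m] m by (simp add: L_def k_def)
  define F where "F = (\<lambda>p. map (\<lambda>n. poly p (fft_root (- 1) k ^ n)) [0..<L])"
  have c_x: "computes (padded_fft k xs) (F (Poly xs)) (2 * k * L) (9 * L)"
    unfolding F_def L_def by (rule computes_padded_fft) (use xs mL in \<open>simp add: L_def\<close>)
  have c_y: "computes (padded_fft k ys) (F (Poly ys)) (2 * k * L) (9 * L)"
    unfolding F_def L_def by (rule computes_padded_fft) (use ys mL in \<open>simp add: L_def\<close>)
  let ?p = "Poly xs * Poly ys"
  have "computes (mapM (\<lambda>j. mulM (F (Poly xs) ! j) (F (Poly ys) ! j)) [0..<L])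
      (map (\<lambda>j. F (Poly xs) ! j * F (Poly ys) ! j) [0..<L]) L (2 * L + 1)"
    using computes_mapM[OF computes_arith(3), of "[0..<L]" _ _ 1] by simp
  moreover have "map (\<lambda>j. F (Poly xs) ! j * F (Poly ys) ! j) [0..<L] = F ?p"
    by (simp add: F_def)
  ultimately have c_z: "computes (mapM (\<lambda>j. mulM (F (Poly xs) ! j) (F (Poly ys) ! j)) [0..<L])
      (F ?p) L (2 * L + 1)" by simp
  have c_inv: "computes (inverse_fft k (F ?p)) (map (coeff ?p) [0..<L]) (2 * k * L + L + 1) (8 * L)"
    unfolding F_def L_def
    by (rule computes_inverse_fft) (use degree_Poly_mult_less[OF m xs ys] in \<open>simp add: k_def\<close>)
  have "take m (map (coeff ?p) [0..<L]) = prefix m (series xs * series ys)"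
    using mL by (simp add: prefix_def series_def take_map flip: fps_of_poly_mult)
  then have c_ret: "computes (return (take m (map (coeff ?p) [0..<L])))
      (prefix m (series xs * series ys)) 0 m"
    by (metis computes_return cells_complex_list length_prefix order_refl)
  have L1: "1 \<le> L" by (simp add: L_def)
  show ?thesis
    unfolding series_mulM_def k_def[symmetric] L_def[symmetric]
    by (rule computes_mono, (rule computes_bind_max c_x c_y c_z c_inv c_ret)+)
      (use L1 mL in \<open>simp_all add: F_def algebra_simps\<close>)
qed

text \<open>The logarithmic factor is taken at the final precision \<open>N\<close> although the
  product has precision \<open>m\<close>. The cost per coefficient is then the same in all Newton
  passes, and only the geometric sum of the precisions remains.\<close>

lemma computes_series_mulM:
  fixes xs ys :: "complex list"
  assumes m: "1 \<le> m" "m \<le> N" and len: "length xs \<le> m" "length ys \<le> m"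
  shows "computes (series_mulM m xs ys) (prefix m (series xs * series ys))
    ((24 * fft_exp N + 12) * m) (44 * m)"
proof (rule computes_mono[OF computes_series_mulM_exp[OF m(1) len]])
  have "(6 * fft_exp m + 3) * 2 ^ fft_exp m \<le> (6 * fft_exp N + 3) * (4 * m)"
    by (intro mult_mono add_mono fft_exp_mono fft_exp_le order_refl m) simp_all
  then show "(6 * fft_exp m + 3) * 2 ^ fft_exp m \<le> (24 * fft_exp N + 12) * m"
    by (simp add: algebra_simps)
  show "11 * 2 ^ fft_exp m \<le> 44 * m" using fft_exp_le[OF m(1)] by simp
qed

section \<open>Newton inversion of scalar series\<close>

lemma sum_two_power_le:
  assumes "N > 0"
  shows "(\<Sum>r=0..<ceillog2 N. T * 2 ^ Suc r) \<le> (T * (4 * N) :: nat)"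
proof -
  have "(\<Sum>r=0..<R. 2 ^ Suc r) \<le> (2 * 2 ^ R :: nat)" for R
    by (induction R) auto
  then have "(\<Sum>r=0..<ceillog2 N. 2 ^ Suc r) \<le> (4 * N :: nat)"
    \<comment> \<open>Rounding the exponent up costs at most a factor 2, as
      \<open>2 ^ ceillog2 N < 2 * N\<close>; the other factor 2 is that of the geometric
      sum.\<close>
    by (rule order_trans) (use two_power_ceillog2_gt[OF assms] in simp)
  then show ?thesis unfolding sum_distrib_left[symmetric] by (rule mult_left_mono) simp
qed

lemma series_newton_step:
  fixes a b c :: "'a::comm_ring_1 fps"
  assumes "a * c = 1" "fps_cong n b c"
  shows "fps_cong (2 * n) (b * (2 - a * b)) c"
proof -
  \<comment> \<open>The factors \<open>1\<close> are made explicit so that they can be rewritten to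
    \<open>a * c\<close>; every term is then divisible by \<open>a\<close>, and the square of
    \<open>c - b\<close> appears.\<close>
  have "c - b * (2 - a * b) = c * 1 - 2 * b * 1 + a * b * b"
    by (simp add: algebra_simps)
  also have "\<dots> = (c - b) * (a * (c - b))"
    unfolding assms(1)[symmetric] by (simp add: algebra_simps)
  finally have eq: "c - b * (2 - a * b) = (c - b) * (a * (c - b))" .
  have "fps_cong n (c - b) 0"
    using fps_cong_diff[OF fps_cong_sym[OF assms(2)] fps_cong_refl[of n b]] by simp
  moreover from fps_cong_mult[OF fps_cong_refl[of n a] this] have "fps_cong n (a * (c - b)) 0"
    by simp
  ultimately have "(c - b * (2 - a * b)) $ k = 0" if "k < 2 * n" for k
    unfolding eq by (rule fps_mult_nth_eq_0) (use that in simp)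
  then show ?thesis by (auto simp: fps_cong_def)
qed

text \<open>Per coefficient a pass costs two products and one subtraction,
  \<open>2 * (24 * K + 12) + 1\<close>. The factor 4 is the geometric sum, and the excess of 26 over
  25 pays for the initial division.\<close>

lemma computes_series_invM:
  fixes a :: "complex list"
  assumes N: "1 \<le> N" and len: "length a = N" and a0: "a ! 0 \<noteq> 0"
  shows "computes (series_invM N a) (prefix N (inverse (series a)))
    (4 * (48 * fft_exp N + 26) * N) (100 * N)"
proof -
  let ?c = "inverse (series a)"
  have ac: "series a * ?c = 1"
    using a0 len N by (simp add: inverse_mult_eq_1' series_nth)
  define K where "K = fft_exp N"
  define y where "y r = prefix (min (2 ^ r) N) ?c" for r
  define step where "step = (\<lambda>r b. let m = min (2 ^ Suc r) N in do {
      t \<leftarrow> series_mulM m (take m a) b;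
      u \<leftarrow> mapM (\<lambda>k. subM (if k = 0 then 2 else 0) (t ! k)) [0..<m];
      series_mulM m b u })"
  have y0: "[1 / (a ! 0)] = y 0"
    using N len by (simp add: y_def prefix_def series_nth divide_inverse)
  have pass: "computes (step r (y r)) (y (Suc r)) ((48 * K + 25) * 2 ^ Suc r) (47 * N)" for r
  proof -
    define m where "m = min (2 ^ Suc r) N"
    define n where "n = min (2 ^ r) N"
    \<comment> \<open>\<open>m <= 2 * n\<close> survives the cut at \<open>N\<close>, so doubling
      the precision suffices in the truncated last pass too.\<close>
    have mn: "1 \<le> m" "m \<le> N" "n \<le> m" "m \<le> 2 * n" "m \<le> 2 ^ Suc r"
      using N by (auto simp: m_def n_def min_def)
    define b where "b = series (y r)"
    define t where "t = prefix m (series (take m a) * b)"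
    define u where "u = map (\<lambda>k. (if k = 0 then 2 else 0) - t ! k) [0..<m]"
    have len_y: "length (y r) = n" by (simp add: y_def n_def)
    have c_t: "computes (series_mulM m (take m a) (y r)) t ((24 * K + 12) * m) (44 * m)"
      unfolding t_def b_def K_def
      by (rule computes_series_mulM) (use mn len len_y in auto)
    have c_u: "computes (mapM (\<lambda>k. subM (if k = 0 then 2 else 0) (t ! k)) [0..<m]) u m (2 * m + 1)"
      unfolding u_def using computes_mapM[OF computes_arith(2), of "[0..<m]" _ _ 1] by simp
    have c_v: "computes (series_mulM m (y r) u) (prefix m (b * series u)) ((24 * K + 12) * m) (44 * m)"
      unfolding b_def K_def
      by (rule computes_series_mulM) (use mn len len_y in \<open>auto simp: u_def\<close>)
    \<comment> \<open>The program multiplies by \<open>take m a\<close>; modulo \<open>x^m\<close>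
      this is the same as multiplying by \<open>a\<close>, for which the Newton step is
      stated.\<close>
    have "fps_cong m (series u) (2 - series a * b)"
    proof -
      have u_eq: "series u $ k = (2 - series (take m a) * b) $ k" if "k < m" for k
        using that by (simp add: series_nth u_def t_def numeral_fps_const)
      have "fps_cong m (series (take m a)) (series a)"
        using mn len by (simp add: fps_cong_def series_nth)
      then have "fps_cong m (2 - series (take m a) * b) (2 - series a * b)"
        by (intro fps_cong_diff fps_cong_mult fps_cong_refl)
      with u_eq show ?thesis by (simp add: fps_cong_def)
    qed
    then have "fps_cong m (b * series u) (b * (2 - series a * b))"
      by (intro fps_cong_mult fps_cong_refl)
    also have "fps_cong m (b * (2 - series a * b)) ?c"
    proof -
      have "fps_cong n b ?c"
        unfolding b_def y_def n_def by (rule fps_cong_series_prefix)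
      from series_newton_step[OF ac this] mn(4) show ?thesis
        by (simp add: fps_cong_def)
    qed
    finally have "prefix m (b * series u) = y (Suc r)"
      by (simp add: prefix_eq_iff y_def m_def)
    note c_v = c_v[unfolded this]
    have "computes (step r (y r)) (y (Suc r)) ((48 * K + 25) * m) (47 * m)"
      unfolding step_def Let_def m_def[symmetric]
      by (rule computes_mono, (rule computes_bind_max c_t c_u c_v)+)
        (use mn in \<open>simp_all add: t_def u_def algebra_simps\<close>)
    then show ?thesis
      by (rule computes_mono) (use mn in auto)
  qed
  have "computes (loopM step [0..<ceillog2 N] (y 0)) (y (ceillog2 N))
      (\<Sum>r=0..<ceillog2 N. (48 * K + 25) * 2 ^ Suc r) (N + 47 * N)"
    by (rule computes_loopM[where y = y]) (use pass in \<open>auto simp: y_def\<close>)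
  moreover have "y (ceillog2 N) = prefix N ?c"
    using le_two_power_ceillog2[of N] by (simp add: y_def min_def)
  ultimately have loop: "computes (loopM step [0..<ceillog2 N] (y 0)) (prefix N ?c)
      ((48 * K + 25) * (4 * N)) (48 * N)"
    using sum_two_power_le[of N "48 * K + 25"] N by (auto elim!: computes_mono)
  show ?thesis
    unfolding series_invM_def step_def[symmetric] K_def[symmetric]
    by (rule computes_mono, rule computes_bind_max, rule computes_arith, unfold y0, rule loop)
      (use N in \<open>simp_all add: algebra_simps\<close>)
qed

section \<open>Arithmetic of scalar matrices\<close>

lemma mat_to_list_carrier:
  "M \<in> carrier_mat n m \<Longrightarrow> mat_to_list M = map (\<lambda>i. map (\<lambda>j. M $$ (i, j)) [0..<m]) [0..<n]"
  by (auto simp: mat_to_list_def)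

lemma mat_to_list_nth:
  "M \<in> carrier_mat n m \<Longrightarrow> i < n \<Longrightarrow> j < m \<Longrightarrow> mat_to_list M ! i ! j = M $$ (i, j)"
  by (simp add: mat_to_list_carrier)

lemma length_mat_to_list:
  "M \<in> carrier_mat n m \<Longrightarrow> length (mat_to_list M) = n"
  "M \<in> carrier_mat n m \<Longrightarrow> i < n \<Longrightarrow> length (mat_to_list M ! i) = m"
  by (simp_all add: mat_to_list_carrier)

lemma cells_map2_le:
  assumes "\<And>i j. i < a \<Longrightarrow> j < b \<Longrightarrow> cells (g i j) \<le> n"
  shows "cells (map (\<lambda>i. map (g i) [0..<b]) [0..<a]) \<le> a * (b * n)"
proof -
  have "cells (map (g i) [0..<b]) \<le> b * n" if "i < a" for i
    using cells_map_le[of "[0..<b]" "g i" n] assms that by simp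
  then show ?thesis
    using cells_map_le[of "[0..<a]" "\<lambda>i. map (g i) [0..<b]" "b * n"] by simp
qed

lemma cells_mat_to_list:
  fixes M :: "complex mat"
  shows "M \<in> carrier_mat n m \<Longrightarrow> cells (mat_to_list M) \<le> n * m"
  using cells_map2_le[of n m "\<lambda>i j. M $$ (i, j)" 1] by (simp add: mat_to_list_carrier)

text \<open>Each of the two nested maps holds its own entries twice; the inner
  \<open>2 * s * n\<close> is absorbed into \<open>2 * s * s * n\<close>.\<close>

lemma computes_mapM2:
  assumes "\<And>i j. i < s \<Longrightarrow> j < s \<Longrightarrow> computes (f i j) (g i j) t p"
    and "\<And>i j. i < s \<Longrightarrow> j < s \<Longrightarrow> cells (g i j) \<le> n"
  shows "computes (mapM (\<lambda>i. mapM (f i) [0..<s]) [0..<s]) (map (\<lambda>i. map (g i) [0..<s]) [0..<s])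
    (s * s * t) (4 * s * s * n + p)"
proof -
  have row: "computes (mapM (f i) [0..<s]) (map (g i) [0..<s]) (s * t) (2 * s * n + p)" if "i < s" for i
    using computes_mapM[of "[0..<s]" "f i" "g i" t p n] that assms by simp
  have cells: "cells (map (g i) [0..<s]) \<le> s * n" if "i < s" for i
    using cells_map_le[of "[0..<s]" "g i" n] that assms by simp
  have "s * n \<le> s * s * n" by (cases s) simp_all
  then show ?thesis
    using computes_mapM[of "[0..<s]" "\<lambda>i. mapM (f i) [0..<s]" "\<lambda>i. map (g i) [0..<s]", OF row cells]
    by (auto elim!: computes_mono simp: algebra_simps)
qed

lemma computes_mat:
  fixes M :: "complex mat"
  assumes "M \<in> carrier_mat s s"
    and "\<And>i j. i < s \<Longrightarrow> j < s \<Longrightarrow> computes (f i j) (M $$ (i, j)) t p"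
  shows "computes (mapM (\<lambda>i. mapM (f i) [0..<s]) [0..<s]) (mat_to_list M) (s * s * t) (4 * s * s + p)"
  using computes_mapM2[of s f "\<lambda>i j. M $$ (i, j)" t p 1] assms by (simp add: mat_to_list_carrier)

lemma computes_mat_addM:
  assumes "X \<in> carrier_mat s s" "Y \<in> carrier_mat s s"
  shows "computes (mat_addM s (mat_to_list X) (mat_to_list Y)) (mat_to_list (X + Y)) (s * s) (4 * s * s + 1)"
proof -
  have "computes (mat_addM s (mat_to_list X) (mat_to_list Y)) (mat_to_list (X + Y)) (s * s * 1) (4 * s * s + 1)"
    unfolding mat_addM_def
    by (rule computes_mat) (use assms in \<open>simp_all add: mat_to_list_nth computes_arith[simplified]\<close>)
  then show ?thesis by simp
qed

lemma computes_mat_negM: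
  assumes "X \<in> carrier_mat s s"
  shows "computes (mat_negM s (mat_to_list X)) (mat_to_list (- X)) (s * s) (4 * s * s + 1)"
proof -
  have neg: "computes (subM 0 x) (- x) 1 1" for x
    using computes_arith(2)[of 0 x] by simp
  have "computes (mat_negM s (mat_to_list X)) (mat_to_list (- X)) (s * s * 1) (4 * s * s + 1)"
    unfolding mat_negM_def
    by (rule computes_mat) (use assms in \<open>simp_all add: mat_to_list_nth neg[simplified]\<close>)
  then show ?thesis by simp
qed

lemma computes_mat_mulM:
  assumes "X \<in> carrier_mat s s" "Y \<in> carrier_mat s s"
  shows "computes (mat_mulM s (mat_to_list X) (mat_to_list Y)) (mat_to_list (X * Y))
    (2 * s ^ 3) (4 * s * s + 3)"
proof -
  have "computes (mat_mulM s (mat_to_list X) (mat_to_list Y)) (mat_to_list (X * Y))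
      (s * s * (2 * s)) (4 * s * s + 3)"
    unfolding mat_mulM_def
  proof (rule computes_mat)
    fix i j assume ij: "i < s" "j < s"
    define y where "y k = (\<Sum>l<k. X $$ (i, l) * Y $$ (l, j))" for k
    have "computes (loopM (\<lambda>k acc. do {
        p \<leftarrow> mulM (mat_to_list X ! i ! k) (mat_to_list Y ! k ! j); addM acc p }) [0..<s] (y 0))
      (y s) (\<Sum>i=0..<s. 2) (1 + 2)"
    proof (rule computes_loopM[where y = y])
      fix k assume k: "k < s"
      have "y (Suc k) = y k + mat_to_list X ! i ! k * mat_to_list Y ! k ! j"
        using ij k assms by (simp add: y_def mat_to_list_nth)
      then show "computes (mulM (mat_to_list X ! i ! k) (mat_to_list Y ! k ! j) \<bind> addM (y k))
          (y (Suc k)) 2 2"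
        by (simp, intro computes_mono[OF computes_bind_max[OF computes_arith(3) computes_arith(1)]])
          simp_all
    qed simp_all
    moreover have "y s = (X * Y) $$ (i, j)"
      using ij assms by (simp add: y_def scalar_prod_def atLeast0LessThan)
    ultimately show "computes (loopM (\<lambda>k acc. do {
        p \<leftarrow> mulM (mat_to_list X ! i ! k) (mat_to_list Y ! k ! j); addM acc p }) [0..<s] 0)
      ((X * Y) $$ (i, j)) (2 * s) 3"
      by (auto simp: y_def elim!: computes_mono)
  qed (use assms in simp)
  then show ?thesis by (simp add: power3_eq_cube mult_ac)
qed

section \<open>Gauss--Jordan elimination modulo a power of the variable\<close>

text \<open>The last condition provides the pivots: row operations do not enlarge the kernel of the matrix of
  constant coefficients of the left block.\<close>

definition gj_inv :: "nat \<Rightarrow> nat \<Rightarrow> (nat \<Rightarrow> nat \<Rightarrow> complex fps) \<Rightarrow> nat \<Rightarrow> (nat \<Rightarrow> nat \<Rightarrow> complex fps) \<Rightarrow> bool" where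
  "gj_inv N s A i w \<longleftrightarrow>
    (\<forall>r<s. \<forall>j<s. fps_cong N (w r j) (\<Sum>k<s. w r (s + k) * A k j)) \<and>
    (\<forall>r<s. \<forall>j<i. fps_cong N (w r j) (if r = j then 1 else 0)) \<and>
    (\<forall>v. (\<forall>r<s. (\<Sum>j<s. w r j $ 0 * v j) = 0) \<longrightarrow> (\<forall>j<s. v j = 0))"

lemma fps_cong_0: "1 \<le> N \<Longrightarrow> fps_cong N f g \<Longrightarrow> f $ 0 = g $ 0"
  by (simp add: fps_cong_def)

text \<open>Without a pivot, column \<open>i\<close> of the constant coefficients is a combination
  of the preceding unit columns. The vector \<open>v\<close> encodes this relation; it lies in the
  kernel and has \<open>v i = 1\<close>, against the last condition of
  \<open>gj_inv\<close>.\<close>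

lemma gj_inv_pivot:
  assumes "gj_inv N s A i w" "i < s" "1 \<le> N"
  shows "\<exists>r. i \<le> r \<and> r < s \<and> w r i $ 0 \<noteq> 0"
proof (rule ccontr)
  assume none: "\<not> ?thesis"
  define v where "v j = (if j < i then - (w j i $ 0) else if j = i then 1 else 0)" for j
  have "(\<Sum>j<s. w r j $ 0 * v j) = 0" if r: "r < s" for r
  proof -
    have w: "w r j $ 0 = (if r = j then 1 else 0)" if "j < i" for j
      using assms r that fps_cong_0[of N "w r j" "if r = j then 1 else 0"] by (auto simp: gj_inv_def)
    have "(\<Sum>j<s. w r j $ 0 * v j) = (\<Sum>j\<in>{..<i} \<union> {i}. w r j $ 0 * v j)"
      by (rule sum.mono_neutral_right) (use assms in \<open>auto simp: v_def\<close>)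
    also have "\<dots> = (\<Sum>j<i. w r j $ 0 * v j) + w r i $ 0"
      by (subst sum.union_disjoint) (auto simp: v_def)
    also have "(\<Sum>j<i. w r j $ 0 * v j) = (\<Sum>j<i. if r = j then - (w j i $ 0) else 0)"
      by (rule sum.cong) (auto simp: w v_def)
    also have "\<dots> + w r i $ 0 = 0"
      using none r by auto
    finally show ?thesis .
  qed
  then have "v i = 0" using assms unfolding gj_inv_def by blast
  then show False by (simp add: v_def)
qed

text \<open>Only rows from \<open>i\<close> on are exchanged. The finished columns
  \<open>j < i\<close> vanish in these rows modulo \<open>x^N\<close>, so they keep their form, and
  the kernel condition is indifferent to the order of the rows.\<close>

lemma gj_inv_swap:
  assumes "gj_inv N s A i w" "i \<le> p" "p < s"
  shows "gj_inv N s A i (\<lambda>r. w (if r = p then i else if r = i then p else r))"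
proof -
  define \<pi> where "\<pi> r = (if r = p then i else if r = i then p else r)" for r
  have \<pi>: "\<pi> r < s" "\<pi> (\<pi> r) = r" if "r < s" for r
    using that assms by (auto simp: \<pi>_def)
  have \<pi>_eq: "\<pi> r = j \<longleftrightarrow> r = j" if "j < i" for r j
    using that assms by (auto simp: \<pi>_def)
  have "\<forall>j<s. v j = 0" if v: "\<forall>r<s. (\<Sum>j<s. w (\<pi> r) j $ 0 * v j) = 0" for v
  proof -
    have "(\<Sum>j<s. w r j $ 0 * v j) = 0" if "r < s" for r
      using v \<pi>[OF that] by metis
    then show ?thesis using assms(1) unfolding gj_inv_def by blast
  qed
  moreover have "fps_cong N (w (\<pi> r) j) (if r = j then 1 else 0)" if "r < s" "j < i" for r j
  proof -
    have "fps_cong N (w (\<pi> r) j) (if \<pi> r = j then 1 else 0)"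
      using assms(1) \<pi>(1)[OF that(1)] that(2) by (simp add: gj_inv_def)
    then show ?thesis by (simp only: \<pi>_eq[OF that(2)])
  qed
  moreover have "fps_cong N (w (\<pi> r) j) (\<Sum>k<s. w (\<pi> r) (s + k) * A k j)" if "r < s" "j < s" for r j
    using assms(1) \<pi>(1)[OF that(1)] that(2) by (simp add: gj_inv_def)
  ultimately have "gj_inv N s A i (\<lambda>r. w (\<pi> r))"
    unfolding gj_inv_def by blast
  then show ?thesis by (simp only: \<pi>_def)
qed

text \<open>The new matrix is given up to congruence only, since its entries come from truncated
  arithmetic. For the kernel, the row operations on constant coefficients are undone:
  \<open>Q $ 0\<close> is nonzero, so the old pivot row annihilates \<open>v\<close>, and then so
  does every other old row.\<close>

lemma gj_inv_step:
  assumes inv: "gj_inv N s A i w" and i: "i < s" and N: "1 \<le> N"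
    and Q: "fps_cong N (Q * w i i) 1"
    and pivot: "\<And>j. j < 2 * s \<Longrightarrow> fps_cong N (w' i j) (Q * w i j)"
    and other: "\<And>r j. r < s \<Longrightarrow> r \<noteq> i \<Longrightarrow> j < 2 * s \<Longrightarrow> fps_cong N (w' r j) (w r j - w r i * (Q * w i j))"
  shows "gj_inv N s A (Suc i) w'"
proof -
  have lin: "fps_cong N (w r j) (\<Sum>k<s. w r (s + k) * A k j)" if "r < s" "j < s" for r j
    using inv that by (simp add: gj_inv_def)
  have id: "fps_cong N (w r j) (if r = j then 1 else 0)" if "r < s" "j < i" for r j
    using inv that by (simp add: gj_inv_def)
  have lin': "fps_cong N (w' r j) (\<Sum>k<s. w' r (s + k) * A k j)" if rj: "r < s" "j < s" for r j
  proof (cases "r = i")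
    case True
    have "fps_cong N (w' i j) (Q * w i j)"
      using pivot rj by simp
    also have "fps_cong N (Q * w i j) (Q * (\<Sum>k<s. w i (s + k) * A k j))"
      by (intro fps_cong_mult fps_cong_refl lin rj i)
    also have "Q * (\<Sum>k<s. w i (s + k) * A k j) = (\<Sum>k<s. Q * w i (s + k) * A k j)"
      by (simp add: sum_distrib_left mult.assoc)
    also have "fps_cong N \<dots> (\<Sum>k<s. w' i (s + k) * A k j)"
      by (intro fps_cong_sum fps_cong_mult fps_cong_refl fps_cong_sym[OF pivot]) simp
    finally show ?thesis using True by simp
  next
    case False
    have "fps_cong N (w' r j) (w r j - w r i * (Q * w i j))"
      using other rj False by simp
    also have "fps_cong N \<dots> ((\<Sum>k<s. w r (s + k) * A k j) - w r i * (Q * (\<Sum>k<s. w i (s + k) * A k j)))"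
      by (intro fps_cong_diff fps_cong_mult fps_cong_refl lin rj i)
    also have "(\<Sum>k<s. w r (s + k) * A k j) - w r i * (Q * (\<Sum>k<s. w i (s + k) * A k j)) =
        (\<Sum>k<s. (w r (s + k) - w r i * (Q * w i (s + k))) * A k j)"
      by (simp add: sum_distrib_left left_diff_distrib sum_subtractf mult.assoc)
    also have "fps_cong N \<dots> (\<Sum>k<s. w' r (s + k) * A k j)"
      by (intro fps_cong_sum fps_cong_mult fps_cong_refl fps_cong_sym[OF other] rj False) simp
    finally show ?thesis .
  qed
  have id': "fps_cong N (w' r j) (if r = j then 1 else 0)" if rj: "r < s" "j < Suc i" for r j
  proof (cases "j = i")
    case True
    show ?thesis
    proof (cases "r = i")
      case True
      then show ?thesis
        using fps_cong_trans[OF pivot Q] i \<open>j = i\<close> by simp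
    next
      case False
      have "fps_cong N (w' r i) (w r i - w r i * (Q * w i i))"
        using other rj i False by simp
      also have "fps_cong N \<dots> (w r i - w r i * 1)"
        by (intro fps_cong_diff fps_cong_mult fps_cong_refl Q)
      finally show ?thesis using False True by simp
    qed
  next
    case False
    with rj have j: "j < i" by simp
    \<comment> \<open>The pivot row vanishes in the finished columns, so subtracting multiples of it
      leaves them alone.\<close>
    have z: "fps_cong N (Q * w i j) (Q * 0)"
      using fps_cong_mult[OF fps_cong_refl id[OF i j]] j by simp
    show ?thesis
    proof (cases "r = i")
      case True
      then show ?thesis
        using fps_cong_trans[OF pivot z] i j by simp
    next
      case False
      have "fps_cong N (w' r j) (w r j - w r i * (Q * w i j))"
        using other rj i False by simp
      also have "fps_cong N \<dots> ((if r = j then 1 else 0) - w r i * (Q * 0))"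
        by (intro fps_cong_diff fps_cong_mult[OF fps_cong_refl z] id rj j)
      finally show ?thesis by simp
    qed
  qed
  have "\<forall>j<s. v j = 0" if v: "\<forall>r<s. (\<Sum>j<s. w' r j $ 0 * v j) = 0" for v
  proof -
    have Q0: "Q $ 0 * w i i $ 0 = 1"
      using fps_cong_0[OF N Q] by simp
    have "w' i j $ 0 = Q $ 0 * w i j $ 0" if "j < s" for j
      using fps_cong_0[OF N pivot[of j]] that by simp
    then have "(\<Sum>j<s. w' i j $ 0 * v j) = Q $ 0 * (\<Sum>j<s. w i j $ 0 * v j)"
      by (simp add: sum_distrib_left mult.assoc)
    with v i Q0 have zi: "(\<Sum>j<s. w i j $ 0 * v j) = 0" by auto
    have "(\<Sum>j<s. w r j $ 0 * v j) = 0" if r: "r < s" "r \<noteq> i" for r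
    proof -
      have "w' r j $ 0 = w r j $ 0 - w r i $ 0 * Q $ 0 * w i j $ 0" if "j < s" for j
        using fps_cong_0[OF N other[OF r, of j]] that by simp
      then have "(\<Sum>j<s. w' r j $ 0 * v j) =
          (\<Sum>j<s. w r j $ 0 * v j) - w r i $ 0 * Q $ 0 * (\<Sum>j<s. w i j $ 0 * v j)"
        by (simp add: sum_distrib_left left_diff_distrib sum_subtractf mult.assoc)
      with v r zi show ?thesis by auto
    qed
    with zi have "\<forall>r<s. (\<Sum>j<s. w r j $ 0 * v j) = 0" by metis
    then show ?thesis using inv unfolding gj_inv_def by blast
  qed
  with lin' id' show ?thesis unfolding gj_inv_def by blast
qed

lemma swap_rows_nth:
  "i < length W \<Longrightarrow> p < length W \<Longrightarrow> r < length W \<Longrightarrow>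
    swap_rows i p W ! r = W ! (if r = p then i else if r = i then p else r)"
  by (auto simp: swap_rows_def nth_list_update)

text \<open>The elimination program is polymorphic, and so is its analysis. An element matters only
  through \<open>wf x\<close> and the series \<open>ev x\<close> that it represents; an operation
  may return any well-formed element that represents the right series modulo \<open>x^N\<close>. The
  bounds \<open>t\<close> and \<open>p\<close> are common to all three operations.\<close>

locale series_arithmetic =
  fixes inve :: "'a::storable \<Rightarrow> 'a comp" and mul sub :: "'a \<Rightarrow> 'a \<Rightarrow> 'a comp"
    and ev :: "'a \<Rightarrow> complex fps" and wf :: "'a \<Rightarrow> bool" and N n t p :: nat
  assumes N: "1 \<le> N"
    and cells: "wf x \<Longrightarrow> cells x \<le> n"
    and inve: "wf x \<Longrightarrow> ev x $ 0 \<noteq> 0 \<Longrightarrow>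
      wf (result (inve x)) \<and> computes (inve x) (result (inve x)) t p \<and>
      fps_cong N (ev (result (inve x)) * ev x) 1"
    and mul: "wf x \<Longrightarrow> wf y \<Longrightarrow>
      wf (result (mul x y)) \<and> computes (mul x y) (result (mul x y)) t p \<and>
      fps_cong N (ev (result (mul x y))) (ev x * ev y)"
    and sub: "wf x \<Longrightarrow> wf y \<Longrightarrow>
      wf (result (sub x y)) \<and> computes (sub x y) (result (sub x y)) t p \<and>
      fps_cong N (ev (result (sub x y))) (ev x - ev y)"
begin

definition wf_mat :: "nat \<Rightarrow> 'a list list \<Rightarrow> bool" where
  "wf_mat s W \<longleftrightarrow> length W = s \<and> (\<forall>r<s. length (W ! r) = 2 * s \<and> (\<forall>j<2 * s. wf (W ! r ! j)))"

lemma wf_mat_cells: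
  assumes "wf_mat s W" shows "cells W \<le> 2 * s * s * n"
proof -
  have "cells (W ! r) \<le> 2 * s * n" if "r < s" for r
    using cells_list_le[of "W ! r" n] assms that cells by (auto simp: wf_mat_def in_set_conv_nth)
  then show ?thesis
    using cells_list_le[of W "2 * s * n"] assms by (auto simp: wf_mat_def in_set_conv_nth algebra_simps)
qed

text \<open>One inversion, \<open>2 * s\<close> products for the pivot row, and a product and a
  subtraction for fewer than \<open>2 * s * s\<close> other entries make at most
  \<open>7 * s * s\<close> operations of the arithmetic.\<close>

lemma eliminate_column:
  assumes W: "wf_mat s W" and i: "i < s" and W0: "ev (W ! i ! i) $ 0 \<noteq> 0"
    and inv: "gj_inv N s A i (\<lambda>r j. ev (W ! r ! j))"
  shows "\<exists>V. (wf_mat s V \<and> gj_inv N s A (Suc i) (\<lambda>r j. ev (V ! r ! j))) \<and>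
    computes (do {
      q \<leftarrow> inve (W ! i ! i);
      row \<leftarrow> mapM (\<lambda>j. mul q (W ! i ! j)) [0..<2 * s];
      mapM (\<lambda>r.
        if r = i then return row
        else mapM (\<lambda>j. do { t \<leftarrow> mul (W ! r ! i) (row ! j); sub (W ! r ! j) t }) [0..<2 * s])
      [0..<s] }) V (7 * s * s * t) (14 * s * s * n + p)"
proof -
  have wf: "wf (W ! r ! j)" if "r < s" "j < 2 * s" for r j
    using W that by (simp add: wf_mat_def)
  define q where "q = result (inve (W ! i ! i))"
  have q: "wf q" "computes (inve (W ! i ! i)) q t p" "fps_cong N (ev q * ev (W ! i ! i)) 1"
    using inve[OF wf[of i i] W0] i by (simp_all add: q_def)
  define row where "row = map (\<lambda>j. result (mul q (W ! i ! j))) [0..<2 * s]"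
  have row: "wf (row ! j)" "fps_cong N (ev (row ! j)) (ev q * ev (W ! i ! j))" if "j < 2 * s" for j
    using mul[OF q(1) wf[OF i that]] that by (simp_all add: row_def)
  have c_row: "computes (mapM (\<lambda>j. mul q (W ! i ! j)) [0..<2 * s]) row (2 * s * t) (4 * s * n + p)"
  proof -
    have "computes (mapM (\<lambda>j. mul q (W ! i ! j)) [0..<2 * s]) row
        (length [0..<2 * s] * t) (2 * length [0..<2 * s] * n + p)"
      unfolding row_def
      by (rule computes_mapM) (use mul[OF q(1) wf[OF i]] cells in auto)
    then show ?thesis by simp
  qed
  define e where "e r j = result (sub (W ! r ! j) (result (mul (W ! r ! i) (row ! j))))" for r j
  have e: "wf (e r j)" "fps_cong N (ev (e r j)) (ev (W ! r ! j) - ev (W ! r ! i) * (ev q * ev (W ! i ! j)))"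
    "computes (do { t \<leftarrow> mul (W ! r ! i) (row ! j); sub (W ! r ! j) t }) (e r j) (2 * t) (n + p)"
    if r: "r < s" and j: "j < 2 * s" for r j
  proof -
    define x where "x = result (mul (W ! r ! i) (row ! j))"
    have x: "wf x" "computes (mul (W ! r ! i) (row ! j)) x t p" "fps_cong N (ev x) (ev (W ! r ! i) * ev (row ! j))"
      using mul[OF wf[of r i] row(1)[OF j]] r i by (simp_all add: x_def)
    have y: "wf (e r j)" "computes (sub (W ! r ! j) x) (e r j) t p" "fps_cong N (ev (e r j)) (ev (W ! r ! j) - ev x)"
      using sub[OF wf[OF r j] x(1)] by (simp_all add: e_def x_def)
    show "wf (e r j)" by (rule y(1))
    show "computes (do { t \<leftarrow> mul (W ! r ! i) (row ! j); sub (W ! r ! j) t }) (e r j) (2 * t) (n + p)"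
      by (rule computes_mono, rule computes_bind_max, rule x(2), rule y(2)) (use cells[OF x(1)] in auto)
    note y(3)
    also have "fps_cong N (ev (W ! r ! j) - ev x) (ev (W ! r ! j) - ev (W ! r ! i) * ev (row ! j))"
      by (intro fps_cong_diff fps_cong_refl x)
    also have "fps_cong N \<dots> (ev (W ! r ! j) - ev (W ! r ! i) * (ev q * ev (W ! i ! j)))"
      by (intro fps_cong_diff fps_cong_mult fps_cong_refl row j)
    finally show "fps_cong N (ev (e r j)) \<dots>" .
  qed
  define V where "V = map (\<lambda>r. if r = i then row else map (e r) [0..<2 * s]) [0..<s]"
  have V: "V ! i = row" "\<And>r j. r < s \<Longrightarrow> r \<noteq> i \<Longrightarrow> j < 2 * s \<Longrightarrow> V ! r ! j = e r j"
    using i by (simp_all add: V_def)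
  have wf_V: "wf_mat s V"
    unfolding wf_mat_def
  proof (intro conjI allI impI)
    fix r j assume "r < s" "j < 2 * s"
    then show "wf (V ! r ! j)"
      using V row(1) e(1) by (cases "r = i") simp_all
  qed (auto simp: V_def row_def)
  have len_row: "length row = 2 * s" by (simp add: row_def)
  have cells_row: "cells row \<le> 2 * s * n"
    using cells_list_le[of row n] row(1) cells len_row by (metis in_set_conv_nth)
  have c_V: "computes (mapM (\<lambda>r. if r = i then return row
        else mapM (\<lambda>j. do { t \<leftarrow> mul (W ! r ! i) (row ! j); sub (W ! r ! j) t }) [0..<2 * s]) [0..<s])
      V (s * (4 * s * t)) (2 * s * (2 * s * n) + (4 * s * n + n + p))"
  proof -
    have "computes (mapM (\<lambda>r. if r = i then return row
        else mapM (\<lambda>j. do { t \<leftarrow> mul (W ! r ! i) (row ! j); sub (W ! r ! j) t }) [0..<2 * s]) [0..<s])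
      V (length [0..<s] * (4 * s * t)) (2 * length [0..<s] * (2 * s * n) + (4 * s * n + n + p))"
      unfolding V_def
    proof (rule computes_mapM)
      fix r assume "r \<in> set [0..<s]"
      then have r: "r < s" by simp
      show "cells (if r = i then row else map (e r) [0..<2 * s]) \<le> 2 * s * n"
        using cells_row cells_map_le[of "[0..<2 * s]" "e r" n] e(1)[OF r] cells by auto
      have "computes (mapM (\<lambda>j. do { t \<leftarrow> mul (W ! r ! i) (row ! j); sub (W ! r ! j) t }) [0..<2 * s])
          (map (e r) [0..<2 * s]) (length [0..<2 * s] * (2 * t)) (2 * length [0..<2 * s] * n + (n + p))"
        by (rule computes_mapM) (use e[OF r] cells in auto)
      then show "computes (if r = i then return row
          else mapM (\<lambda>j. do { t \<leftarrow> mul (W ! r ! i) (row ! j); sub (W ! r ! j) t }) [0..<2 * s])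
          (if r = i then row else map (e r) [0..<2 * s]) (4 * s * t) (4 * s * n + n + p)"
        using cells_row by (auto intro!: computes_return elim!: computes_mono)
    qed
    then show ?thesis by simp
  qed
  \<comment> \<open>Writing \<open>s\<close> as a successor turns estimates such as
    \<open>s <= s * s\<close> into comparisons of polynomials in \<open>d\<close> that
    simplification settles after expansion. Later cost estimates use the same device.\<close>
  obtain d where d: "s = Suc d" using i by (cases s) simp_all
  have "computes (do {
      q \<leftarrow> inve (W ! i ! i);
      row \<leftarrow> mapM (\<lambda>j. mul q (W ! i ! j)) [0..<2 * s];
      mapM (\<lambda>r.
        if r = i then return row
        else mapM (\<lambda>j. do { t \<leftarrow> mul (W ! r ! i) (row ! j); sub (W ! r ! j) t }) [0..<2 * s])
      [0..<s] }) V (7 * s * s * t) (14 * s * s * n + p)"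
    by (rule computes_mono, (rule computes_bind_max q(2) c_row c_V)+)
      (use cells_row cells[OF q(1)] in \<open>simp_all add: d algebra_simps\<close>)
  moreover have "gj_inv N s A (Suc i) (\<lambda>r j. ev (V ! r ! j))"
    by (rule gj_inv_step[OF inv i N q(3)]) (use V row e in auto)
  ultimately show ?thesis using wf_V by blast
qed

text \<open>The final matrix is known only through the invariant, as it depends on
  \<open>pv\<close>. Storage: one column takes \<open>14 * s * s * n + p\<close>; the permuted copy
  and the state of the loop add \<open>2 * s * s * n\<close> each.\<close>

theorem computes_gauss_jordan:
  assumes W: "wf_mat s W" and inv: "gj_inv N s A 0 (\<lambda>r j. ev (W ! r ! j))"
    and pv: "pivot_rule ok pv" and ok: "\<And>x. wf x \<Longrightarrow> ok x \<longleftrightarrow> ev x $ 0 \<noteq> 0"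
  shows "\<exists>V. (wf_mat s V \<and> gj_inv N s A s (\<lambda>r j. ev (V ! r ! j))) \<and>
    computes (Defs.gauss_jordan inve mul sub pv s W) V (7 * s ^ 3 * t) (18 * s * s * n + p)"
proof -
  define Inv where "Inv i W \<longleftrightarrow> wf_mat s W \<and> gj_inv N s A i (\<lambda>r j. ev (W ! r ! j))" for i W
  have "\<exists>V. Inv s V \<and> computes (Defs.gauss_jordan inve mul sub pv s W) V (\<Sum>i=0..<s. 7 * s * s * t)
    (2 * s * s * n + (16 * s * s * n + p))"
    unfolding Defs.gauss_jordan_def
  proof (rule computes_loopM_inv[where Inv = Inv])
    fix i W assume i: "i < s" and "Inv i W"
    then have W: "wf_mat s W" and inv: "gj_inv N s A i (\<lambda>r j. ev (W ! r ! j))"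
      by (simp_all add: Inv_def)
    define W' where "W' = swap_rows i (pv i W) W"
    have len: "length W = s" using W by (simp add: wf_mat_def)
    have ok': "ok (W ! r ! i) \<longleftrightarrow> ev (W ! r ! i) $ 0 \<noteq> 0" if "r < s" for r
      using W i that by (intro ok) (simp add: wf_mat_def)
    obtain r where "i \<le> r \<and> r < length W \<and> ok (W ! r ! i)"
      using gj_inv_pivot[OF inv i N] len ok' by blast
    then have "i \<le> pv i W" "pv i W < s" "ok (W ! pv i W ! i)"
      using pv unfolding pivot_rule_def len[symmetric] by blast+
    then have pvi: "i \<le> pv i W" "pv i W < s" "ev (W ! pv i W ! i) $ 0 \<noteq> 0"
      using ok' by blast+
    have nth: "W' ! r = W ! (if r = pv i W then i else if r = i then pv i W else r)" if "r < s" for r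
      unfolding W'_def by (rule swap_rows_nth) (use len i pvi that in auto)
    have W': "wf_mat s W'"
      unfolding wf_mat_def
    proof (intro conjI allI impI)
      show "length W' = s" by (simp add: W'_def swap_rows_def len)
    qed (use W i pvi nth in \<open>auto simp: wf_mat_def\<close>)
    have piv: "ev (W' ! i ! i) $ 0 \<noteq> 0"
      using nth[OF i] pvi(3) by auto
    have "gj_inv N s A i (\<lambda>r j. ev (W ! (if r = pv i W then i else if r = i then pv i W else r) ! j))"
      by (rule gj_inv_swap[OF inv pvi(1,2)])
    then have inv': "gj_inv N s A i (\<lambda>r j. ev (W' ! r ! j))"
      using nth by (simp add: gj_inv_def)
    from eliminate_column[OF W' i piv inv'] obtain V where
      V: "Inv (Suc i) V" and c_V: "computes (do {
        q \<leftarrow> inve (W' ! i ! i);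
        row \<leftarrow> mapM (\<lambda>j. mul q (W' ! i ! j)) [0..<2 * s];
        mapM (\<lambda>r.
          if r = i then return row
          else mapM (\<lambda>j. do { t \<leftarrow> mul (W' ! r ! i) (row ! j); sub (W' ! r ! j) t }) [0..<2 * s])
        [0..<s] }) V (7 * s * s * t) (14 * s * s * n + p)"
      unfolding Inv_def by blast
    have "computes (do {
        W \<leftarrow> return W';
        q \<leftarrow> inve (W ! i ! i);
        row \<leftarrow> mapM (\<lambda>j. mul q (W ! i ! j)) [0..<2 * s];
        mapM (\<lambda>r.
          if r = i then return row
          else mapM (\<lambda>j. do { t \<leftarrow> mul (W ! r ! i) (row ! j); sub (W ! r ! j) t }) [0..<2 * s])
        [0..<s] }) V (7 * s * s * t) (16 * s * s * n + p)"
      by (rule computes_mono, rule computes_bind_max[OF computes_return[OF order_refl]], rule c_V)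
        (use wf_mat_cells[OF W'] in \<open>auto simp: algebra_simps\<close>)
    with V show "\<exists>V. Inv (Suc i) V \<and> computes (do {
        W \<leftarrow> return (swap_rows i (pv i W) W);
        q \<leftarrow> inve (W ! i ! i);
        row \<leftarrow> mapM (\<lambda>j. mul q (W ! i ! j)) [0..<2 * s];
        mapM (\<lambda>r.
          if r = i then return row
          else mapM (\<lambda>j. do { t \<leftarrow> mul (W ! r ! i) (row ! j); sub (W ! r ! j) t }) [0..<2 * s])
        [0..<s] }) V (7 * s * s * t) (16 * s * s * n + p)"
      unfolding W'_def by blast
  qed (use W inv wf_mat_cells in \<open>auto simp: Inv_def\<close>)
  then show ?thesis
    unfolding Inv_def by (auto elim!: computes_mono simp: power3_eq_cube algebra_simps)
qed

end

section \<open>Matrix sequences as matrices of power series\<close>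

text \<open>In this encoding the entries lie in a commutative ring, so determinant and adjugate are
  available; a series with matrix coefficients would not offer them.\<close>

definition series_mat :: "nat \<Rightarrow> (nat \<Rightarrow> complex mat) \<Rightarrow> complex fps mat" where
  "series_mat s A = mat s s (\<lambda>(i, j). Abs_fps (\<lambda>k. A k $$ (i, j)))"

definition coeff_mat :: "nat \<Rightarrow> complex fps mat \<Rightarrow> complex mat" where
  "coeff_mat k F = map_mat (\<lambda>f. f $ k) F"

definition mat_cong :: "nat \<Rightarrow> nat \<Rightarrow> complex fps mat \<Rightarrow> complex fps mat \<Rightarrow> bool" where
  "mat_cong s m F G \<longleftrightarrow> (\<forall>i<s. \<forall>j<s. fps_cong m (F $$ (i, j)) (G $$ (i, j)))"

definition mat_prefix :: "nat \<Rightarrow> complex fps mat \<Rightarrow> complex list list list" where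
  "mat_prefix m F = map (\<lambda>k. mat_to_list (coeff_mat k F)) [0..<m]"

definition list_series :: "nat \<Rightarrow> complex list list list \<Rightarrow> complex fps mat" where
  "list_series s X = mat s s (\<lambda>(i, j). series (map (\<lambda>M. M ! i ! j) X))"

lemma series_mat_carrier [simp]: "series_mat s A \<in> carrier_mat s s"
  and list_series_carrier [simp]: "list_series s X \<in> carrier_mat s s"
  and coeff_mat_carrier [simp]: "F \<in> carrier_mat n m \<Longrightarrow> coeff_mat k F \<in> carrier_mat n m"
  by (simp_all add: series_mat_def list_series_def coeff_mat_def)

lemma series_mat_nth: "i < s \<Longrightarrow> j < s \<Longrightarrow> series_mat s A $$ (i, j) $ k = A k $$ (i, j)"
  by (simp add: series_mat_def)

lemma coeff_mat_index:
  "F \<in> carrier_mat n m \<Longrightarrow> i < n \<Longrightarrow> j < m \<Longrightarrow> coeff_mat k F $$ (i, j) = F $$ (i, j) $ k"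
  by (simp add: coeff_mat_def)

lemma coeff_series_mat: "A k \<in> carrier_mat s s \<Longrightarrow> coeff_mat k (series_mat s A) = A k"
  by (rule eq_matI) (auto simp: coeff_mat_def series_mat_def)

lemma series_coeff_mat: "F \<in> carrier_mat s s \<Longrightarrow> series_mat s (\<lambda>k. coeff_mat k F) = F"
  by (rule eq_matI) (auto simp: coeff_mat_def series_mat_def fps_eq_iff)

lemma index_mult_mat_sum:
  "X \<in> carrier_mat s s \<Longrightarrow> Y \<in> carrier_mat s s \<Longrightarrow> i < s \<Longrightarrow> j < s \<Longrightarrow>
    (X * Y) $$ (i, j) = (\<Sum>k<s. X $$ (i, k) * Y $$ (k, j))"
  by (simp add: scalar_prod_def atLeast0LessThan)

lemma coeff_mult_index:
  assumes "F \<in> carrier_mat s s" "G \<in> carrier_mat s s" "i < s" "j < s"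
  shows "(F * G) $$ (i, j) $ k = (\<Sum>l\<le>k. (coeff_mat l F * coeff_mat (k - l) G) $$ (i, j))"
proof -
  have "(F * G) $$ (i, j) $ k = (\<Sum>q<s. \<Sum>l\<le>k. F $$ (i, q) $ l * G $$ (q, j) $ (k - l))"
    by (simp add: index_mult_mat_sum[OF assms] fps_sum_nth fps_mult_nth atLeast0AtMost del: index_mult_mat)
  also have "\<dots> = (\<Sum>l\<le>k. (coeff_mat l F * coeff_mat (k - l) G) $$ (i, j))"
    using assms
    by (subst sum.swap) (simp add: index_mult_mat_sum[of _ s] coeff_mat_index[of _ s s] del: index_mult_mat)
  finally show ?thesis .
qed

lemma series_mat_conv:
  assumes "\<And>k. A k \<in> carrier_mat s s" "\<And>k. B k \<in> carrier_mat s s"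
  shows "series_mat s (conv s A B) = series_mat s A * series_mat s B"
proof (rule eq_matI)
  fix i j
  assume "i < dim_row (series_mat s A * series_mat s B)" "j < dim_col (series_mat s A * series_mat s B)"
  then have ij: "i < s" "j < s" by (simp_all add: series_mat_def)
  show "series_mat s (conv s A B) $$ (i, j) = (series_mat s A * series_mat s B) $$ (i, j)"
    using ij assms
    by (intro fps_ext)
      (simp add: series_mat_nth conv_def coeff_mult_index[of _ s] coeff_series_mat del: index_mult_mat)
qed (simp_all add: series_mat_def)

lemma series_mat_e0: "series_mat s (e0 s) = 1\<^sub>m s"
  by (rule eq_matI) (auto simp: series_mat_def e0_def fps_eq_iff)

section \<open>Existence and uniqueness of the convolution inverse\<close>

lemma invertible_matE:
  assumes "A \<in> carrier_mat s s" "invertible_mat A"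
  obtains B where "B \<in> carrier_mat s s" "A * B = 1\<^sub>m s"
proof -
  obtain B where B: "A * B = 1\<^sub>m s" "B * A = 1\<^sub>m (dim_row B)"
    using assms by (auto simp: invertible_mat_def inverts_mat_def)
  \<comment> \<open>\<open>invertible_mat\<close> leaves the shape of the inverse open; it is read
    off the columns of the two identity matrices.\<close>
  have "dim_col B = s" using arg_cong[OF B(1), of dim_col] by simp
  moreover have "dim_row B = s" using arg_cong[OF B(2), of dim_col] assms(1) by simp
  ultimately show ?thesis using that B(1) by blast
qed

text \<open>Taking constant coefficients is a ring homomorphism and so commutes with
  \<open>det\<close>; this makes \<open>det F\<close> a unit of the power series ring. The adjugate
  scaled by its inverse is inverse to \<open>F\<close> on both sides.\<close>

lemma series_mat_inverse:
  assumes F: "F \<in> carrier_mat s s" and inv: "invertible_mat (coeff_mat 0 F)"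
  obtains B where "B \<in> carrier_mat s s" "F * B = 1\<^sub>m s" "B * F = 1\<^sub>m s"
proof -
  interpret comm_ring_hom "\<lambda>f :: complex fps. f $ 0"
    by unfold_locales simp_all
  have F0: "coeff_mat 0 F \<in> carrier_mat s s" using F by simp
  obtain X where X: "X \<in> carrier_mat s s" "coeff_mat 0 F * X = 1\<^sub>m s"
    using invertible_matE[OF F0 inv] .
  have "det (coeff_mat 0 F) * det X = 1"
    using det_mult[OF F0 X(1)] X(2) by simp
  then have "det F $ 0 \<noteq> 0"
    by (auto simp: coeff_mat_def)
  then have unit: "inverse (det F) * det F = 1"
    by (rule inverse_mult_eq_1)
  define B where "B = inverse (det F) \<cdot>\<^sub>m adj_mat F"
  note adj = adj_mat[OF F]
  have scale: "inverse (det F) \<cdot>\<^sub>m (det F \<cdot>\<^sub>m 1\<^sub>m s) = 1\<^sub>m s"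
    by (rule eq_matI) (use unit in auto)
  show ?thesis
  proof
    show "B \<in> carrier_mat s s" using adj by (simp add: B_def)
    show "F * B = 1\<^sub>m s"
      using adj F scale by (simp add: B_def mult_smult_distrib[of _ s s])
    show "B * F = 1\<^sub>m s"
      using adj F scale by (simp add: B_def mult_smult_assoc_mat[of _ s s])
  qed
qed

text \<open>\<open>conv_inverse\<close> is a definite description, so uniqueness is needed besides
  the two equations. It is the associativity argument
  \<open>X = (B * A) * X = B * (A * X) = B\<close>, with \<open>A\<close> and \<open>X\<close> read
  as matrix series.\<close>

lemma conv_inverse_eq:
  assumes A: "\<And>k. A k \<in> carrier_mat s s" and B: "B \<in> carrier_mat s s"
    and AB: "series_mat s A * B = 1\<^sub>m s" and BA: "B * series_mat s A = 1\<^sub>m s"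
  shows "conv_inverse s A = (\<lambda>k. coeff_mat k B)"
proof -
  have conv_e0: "conv s X Y = e0 s \<longleftrightarrow> series_mat s X * series_mat s Y = 1\<^sub>m s"
    if "\<And>k. X k \<in> carrier_mat s s" "\<And>k. Y k \<in> carrier_mat s s" for X Y
  proof
    assume "conv s X Y = e0 s"
    then show "series_mat s X * series_mat s Y = 1\<^sub>m s"
      using series_mat_conv[of X s Y] that series_mat_e0[of s] by simp
  next
    assume eq: "series_mat s X * series_mat s Y = 1\<^sub>m s"
    show "conv s X Y = e0 s"
    proof
      fix k
      have "coeff_mat k (series_mat s (conv s X Y)) = coeff_mat k (series_mat s (e0 s))"
        using series_mat_conv[of X s Y] that eq series_mat_e0[of s] by simp
      then show "conv s X Y k = e0 s k"
        by (simp add: coeff_series_mat conv_def e0_def)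
    qed
  qed
  show ?thesis
    unfolding conv_inverse_def
  proof (rule the_equality)
    show "(\<forall>k. coeff_mat k B \<in> carrier_mat s s) \<and> conv s A (\<lambda>k. coeff_mat k B) = e0 s \<and>
        conv s (\<lambda>k. coeff_mat k B) A = e0 s"
      using A B AB BA by (simp add: conv_e0 series_coeff_mat)
  next
    fix X assume X: "(\<forall>k. X k \<in> carrier_mat s s) \<and> conv s A X = e0 s \<and> conv s X A = e0 s"
    have "series_mat s X = (B * series_mat s A) * series_mat s X"
      unfolding BA by (rule left_mult_one_mat[OF series_mat_carrier, symmetric])
    also have "\<dots> = B * (series_mat s A * series_mat s X)"
      by (rule assoc_mult_mat[OF B series_mat_carrier series_mat_carrier])
    also have "series_mat s A * series_mat s X = 1\<^sub>m s"
      using conv_e0[of A X] X A by blast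
    also have "B * 1\<^sub>m s = B"
      using B by simp
    finally have eq: "series_mat s X = B" .
    show "X = (\<lambda>k. coeff_mat k B)"
      unfolding eq[symmetric] using X by (simp add: coeff_series_mat)
  qed
qed

section \<open>Congruence and truncation of matrix series\<close>

lemma mat_cong_refl [simp]: "mat_cong s m F F"
  and mat_cong_trans [trans]: "mat_cong s m F G \<Longrightarrow> mat_cong s m G H \<Longrightarrow> mat_cong s m F H"
  unfolding mat_cong_def by (blast intro: fps_cong_refl fps_cong_sym fps_cong_trans)+

lemma mat_cong_mult:
  assumes "F \<in> carrier_mat s s" "F' \<in> carrier_mat s s" "G \<in> carrier_mat s s" "G' \<in> carrier_mat s s"
    and "mat_cong s m F F'" "mat_cong s m G G'"
  shows "mat_cong s m (F * G) (F' * G')"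
  using assms unfolding mat_cong_def
  by (auto simp: index_mult_mat_sum[of _ s] simp del: index_mult_mat intro!: fps_cong_sum fps_cong_mult)

lemma length_mat_prefix [simp]: "length (mat_prefix m F) = m"
  by (simp add: mat_prefix_def)

lemma mat_prefix_nth: "k < m \<Longrightarrow> mat_prefix m F ! k = mat_to_list (coeff_mat k F)"
  by (simp add: mat_prefix_def)

lemma take_mat_prefix: "m \<le> n \<Longrightarrow> take m (mat_prefix n F) = mat_prefix m F"
  by (simp add: mat_prefix_def take_map)

lemma mat_prefix_cong:
  assumes "F \<in> carrier_mat s s" "G \<in> carrier_mat s s" "mat_cong s m F G"
  shows "mat_prefix m F = mat_prefix m G"
proof -
  have "coeff_mat k F = coeff_mat k G" if "k < m" for k
    using assms that by (intro eq_matI) (auto simp: coeff_mat_def mat_cong_def fps_cong_def)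
  then show ?thesis by (simp add: mat_prefix_def)
qed

lemma cells_mat_prefix: "F \<in> carrier_mat s s \<Longrightarrow> cells (mat_prefix m F) \<le> m * (s * s)"
  using cells_map_le[of "[0..<m]" "\<lambda>k. mat_to_list (coeff_mat k F)" "s * s"]
  by (simp add: mat_prefix_def cells_mat_to_list)

lemma cells_mat_prefix_le:
  assumes "F \<in> carrier_mat s s" "m \<le> N"
  shows "cells (mat_prefix m F) \<le> s * s * N"
  using order_trans[OF cells_mat_prefix[OF assms(1)] mult_le_mono1[OF assms(2)]] by (simp add: mult_ac)

lemma list_series_nth:
  "i < s \<Longrightarrow> j < s \<Longrightarrow> list_series s X $$ (i, j) $ k = (if k < length X then X ! k ! i ! j else 0)"
  by (simp add: list_series_def series_nth)

lemma list_series_prefix: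
  "F \<in> carrier_mat s s \<Longrightarrow> mat_cong s m (list_series s (mat_prefix m F)) F"
  by (auto simp: mat_cong_def fps_cong_def list_series_nth mat_prefix_nth mat_to_list_nth[of _ s s]
      coeff_mat_index)

lemma coeffs_eq_mat_prefix:
  "(\<And>k. A k \<in> carrier_mat s s) \<Longrightarrow> Defs.coeffs N A = mat_prefix N (series_mat s A)"
  by (simp add: Defs.coeffs_def mat_prefix_def coeff_series_mat)

section \<open>Inversion of scalar matrices\<close>

text \<open>The kernel condition holds at the start because the constant coefficients of
  \<open>B\<close> form a left inverse of those of \<open>F\<close>. The left block may be a
  truncation of \<open>F\<close>; the right block is exactly the identity.\<close>

lemma gj_inv_init:
  assumes F: "F \<in> carrier_mat s s" and B: "B \<in> carrier_mat s s" and BF: "B * F = 1\<^sub>m s" and N: "1 \<le> N"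
    and left: "\<And>r j. r < s \<Longrightarrow> j < s \<Longrightarrow> fps_cong N (w r j) (F $$ (r, j))"
    and right: "\<And>r k. r < s \<Longrightarrow> k < s \<Longrightarrow> w r (s + k) = (if r = k then 1 else 0)"
  shows "gj_inv N s (\<lambda>k j. F $$ (k, j)) 0 w"
proof -
  have "(\<Sum>k<s. w r (s + k) * F $$ (k, j)) = F $$ (r, j)" if "r < s" for r j
  proof -
    have "(\<Sum>k<s. w r (s + k) * F $$ (k, j)) = (\<Sum>k<s. if r = k then F $$ (k, j) else 0)"
      using that right by (intro sum.cong) auto
    with that show ?thesis by simp
  qed
  moreover have "v l = 0" if v: "\<forall>r<s. (\<Sum>j<s. w r j $ 0 * v j) = 0" and l: "l < s" for v l
  proof -
    have delta: "(\<Sum>r<s. B $$ (l, r) $ 0 * F $$ (r, j) $ 0) = (if l = j then 1 else 0)" if "j < s" for j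
    proof -
      have "(\<Sum>r<s. B $$ (l, r) $ 0 * F $$ (r, j) $ 0) = (B * F) $$ (l, j) $ 0"
        by (simp add: index_mult_mat_sum[OF B F l that] fps_sum_nth del: index_mult_mat)
      with BF l that show ?thesis by simp
    qed
    have "(\<Sum>j<s. F $$ (r, j) $ 0 * v j) = 0" if "r < s" for r
    proof -
      have "(\<Sum>j<s. F $$ (r, j) $ 0 * v j) = (\<Sum>j<s. w r j $ 0 * v j)"
        by (intro sum.cong refl arg_cong2[where f = "(*)"] fps_cong_0[OF N, symmetric] left that) simp
      with v that show ?thesis by simp
    qed
    then have "0 = (\<Sum>r<s. B $$ (l, r) $ 0 * (\<Sum>j<s. F $$ (r, j) $ 0 * v j))"
      by simp
    also have "\<dots> = (\<Sum>j<s. (\<Sum>r<s. B $$ (l, r) $ 0 * F $$ (r, j) $ 0) * v j)"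
      unfolding sum_distrib_left sum_distrib_right by (subst sum.swap) (simp add: mult.assoc)
    also have "\<dots> = (\<Sum>j<s. if l = j then v j else 0)"
      by (intro sum.cong) (simp_all add: delta)
    finally show ?thesis using l by simp
  qed
  ultimately show ?thesis using left by (simp add: gj_inv_def)
qed

text \<open>The right block \<open>T\<close> satisfies \<open>T * F = 1\<close> modulo
  \<open>x^N\<close>; multiplication by \<open>B\<close> from the right cancels \<open>F\<close> and
  leaves \<open>T\<close> congruent to \<open>B\<close>.\<close>

lemma gj_inv_result:
  assumes F: "F \<in> carrier_mat s s" and B: "B \<in> carrier_mat s s" and FB: "F * B = 1\<^sub>m s"
    and inv: "gj_inv N s (\<lambda>k j. F $$ (k, j)) s w" and rk: "r < s" "k < s"
  shows "fps_cong N (w r (s + k)) (B $$ (r, k))"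
proof -
  define T where "T = mat s s (\<lambda>(r, k). w r (s + k))"
  have T: "T \<in> carrier_mat s s" by (simp add: T_def)
  have "mat_cong s N (T * F) (1\<^sub>m s)"
    unfolding mat_cong_def
  proof (intro allI impI)
    fix i j assume ij: "i < s" "j < s"
    have "(T * F) $$ (i, j) = (\<Sum>k<s. w i (s + k) * F $$ (k, j))"
      unfolding index_mult_mat_sum[OF T F ij] using ij by (simp add: T_def)
    moreover have "fps_cong N (\<Sum>k<s. w i (s + k) * F $$ (k, j)) (w i j)"
      using inv ij by (auto simp: gj_inv_def intro: fps_cong_sym)
    moreover have "fps_cong N (w i j) (1\<^sub>m s $$ (i, j))"
      using inv ij by (simp add: gj_inv_def)
    ultimately show "fps_cong N ((T * F) $$ (i, j)) (1\<^sub>m s $$ (i, j))"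
      by (metis fps_cong_trans)
  qed
  then have "mat_cong s N (T * F * B) (1\<^sub>m s * B)"
    using T F B by (intro mat_cong_mult) simp_all
  moreover have "T * F * B = T"
    using assoc_mult_mat[OF T F B] FB T by simp
  ultimately have "mat_cong s N T B"
    using B by (simp only: left_mult_one_mat)
  then show ?thesis
    using rk by (simp add: mat_cong_def T_def)
qed

lemma map_mat_fps_const_mult:
  assumes "X \<in> carrier_mat s s" "Y \<in> carrier_mat s s" "X * Y = 1\<^sub>m s"
  shows "map_mat fps_const X * map_mat fps_const Y = (1\<^sub>m s :: complex fps mat)"
proof (rule eq_matI)
  fix i j assume "i < dim_row (1\<^sub>m s :: complex fps mat)" "j < dim_col (1\<^sub>m s :: complex fps mat)"
  then have ij: "i < s" "j < s" by simp_all
  have "(map_mat fps_const X * map_mat fps_const Y) $$ (i, j) = fps_const ((X * Y) $$ (i, j))"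
    using assms(1,2) ij
    by (simp add: index_mult_mat_sum[of _ s] fps_eq_iff fps_sum_nth flip: fps_const_mult del: index_mult_mat)
  then show "(map_mat fps_const X * map_mat fps_const Y) $$ (i, j) = 1\<^sub>m s $$ (i, j)"
    using ij assms(3) by simp
qed (use assms in auto)

text \<open>Complex numbers serve as series modulo \<open>x\<close>: for \<open>N = 1\<close>,
  congruence of constant series is equality of numbers.\<close>

interpretation scalar: series_arithmetic "\<lambda>x. divM 1 x" mulM subM fps_const "\<lambda>_. True" 1 1 1 1
  by unfold_locales (auto simp: divM_def mulM_def subM_def computes_def fps_cong_def)

lemma computes_mat_invM:
  assumes M: "M \<in> carrier_mat s s" "B \<in> carrier_mat s s" "M * B = 1\<^sub>m s" "B * M = 1\<^sub>m s" and s: "1 \<le> s"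
  shows "computes (mat_invM s (mat_to_list M)) (mat_to_list B) (7 * s ^ 3) (22 * s * s)"
proof -
  define W where "W = map (\<lambda>i. mat_to_list M ! i @ map (\<lambda>j. if i = j then 1 else 0) [0..<s]) [0..<s]"
  have left: "W ! r ! j = M $$ (r, j)" if "r < s" "j < s" for r j
    using that M by (simp add: W_def nth_append length_mat_to_list mat_to_list_nth)
  have right: "W ! r ! (s + k) = (if r = k then 1 else 0)" if "r < s" "k < s" for r k
    using that M by (simp add: W_def nth_append length_mat_to_list)
  have wf: "scalar.wf_mat s W"
    using M by (simp add: scalar.wf_mat_def W_def length_mat_to_list)
  let ?F = "map_mat fps_const M" and ?B = "map_mat fps_const B"
  have inv: "gj_inv 1 s (\<lambda>k j. ?F $$ (k, j)) 0 (\<lambda>r j. fps_const (W ! r ! j))"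
    by (rule gj_inv_init[of _ _ ?B]) (use M left right in \<open>auto simp: map_mat_fps_const_mult\<close>)
  have pv: "pivot_rule (\<lambda>x. x \<noteq> 0) first_pivot"
    unfolding pivot_rule_def
  proof (intro allI impI)
    fix i :: nat and W :: "complex list list"
    assume "\<exists>r\<ge>i. r < length W \<and> W ! r ! i \<noteq> 0"
    then show "i \<le> first_pivot i W \<and> first_pivot i W < length W \<and> W ! first_pivot i W ! i \<noteq> 0"
      unfolding first_pivot_def by (rule LeastI_ex)
  qed
  obtain V where V: "scalar.wf_mat s V" "gj_inv 1 s (\<lambda>k j. ?F $$ (k, j)) s (\<lambda>r j. fps_const (V ! r ! j))"
    "computes (Defs.gauss_jordan (\<lambda>x. divM 1 x) mulM subM first_pivot s W) V (7 * s ^ 3 * 1) (18 * s * s * 1 + 1)"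
    using scalar.computes_gauss_jordan[OF wf inv pv] by auto
  have "fps_cong 1 (fps_const (V ! r ! (s + k))) (?B $$ (r, k))" if "r < s" "k < s" for r k
    by (rule gj_inv_result[OF _ _ _ V(2) that]) (use M in \<open>auto simp: map_mat_fps_const_mult\<close>)
  then have "V ! r ! (s + k) = B $$ (r, k)" if "r < s" "k < s" for r k
    using that M by (simp add: fps_cong_def)
  moreover have len: "length V = s" "\<And>r. r < s \<Longrightarrow> length (V ! r) = 2 * s"
    using V(1) by (simp_all add: scalar.wf_mat_def)
  ultimately have res: "map (drop s) V = mat_to_list B"
    using M by (auto intro!: nth_equalityI simp: length_mat_to_list mat_to_list_nth)
  have cells_W: "cells W \<le> 2 * s * s" "cells V \<le> 2 * s * s"
    using scalar.wf_mat_cells[OF wf] scalar.wf_mat_cells[OF V(1)] by simp_all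
  have c_ret: "computes (return (map (drop s) V)) (mat_to_list B) 0 (s * s)"
    unfolding res by (rule computes_return) (use M cells_mat_to_list in auto)
  have c_W: "computes (return W) W 0 (2 * s * s)"
    by (rule computes_return) (rule cells_W)
  obtain d where d: "s = Suc d" using s by (cases s) simp_all
  show ?thesis
    unfolding mat_invM_def W_def[symmetric]
    by (rule computes_mono, (rule computes_bind_max c_W V(3) c_ret)+)
      (use cells_W in \<open>simp_all add: d algebra_simps\<close>)
qed

section \<open>The recursive inverse\<close>

lemma coeff_mat_inverse_0:
  assumes "F \<in> carrier_mat s s" "G \<in> carrier_mat s s" "F * G = 1\<^sub>m s"
  shows "coeff_mat 0 F * coeff_mat 0 G = 1\<^sub>m s"
proof (rule eq_matI)
  fix i j assume "i < dim_row (1\<^sub>m s :: complex mat)" "j < dim_col (1\<^sub>m s :: complex mat)"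
  then have ij: "i < s" "j < s" by simp_all
  show "(coeff_mat 0 F * coeff_mat 0 G) $$ (i, j) = 1\<^sub>m s $$ (i, j)"
    using coeff_mult_index[OF assms(1,2) ij, of 0] assms(3) ij by (cases "i = j") simp_all
qed (use assms in \<open>auto simp: coeff_mat_def\<close>)

text \<open>In coefficient \<open>k > 0\<close> of \<open>B * F = 1\<close> the last summand is
  isolated, \<open>?b k * ?f 0 = - S\<close>, and multiplied from the right by \<open>?b 0\<close>,
  the inverse of \<open>?f 0\<close>. Moving this factor into each summand gives the form that the
  program evaluates.\<close>

lemma coeff_mat_recursion:
  assumes F: "F \<in> carrier_mat s s" and B: "B \<in> carrier_mat s s"
    and FB: "F * B = 1\<^sub>m s" and BF: "B * F = 1\<^sub>m s" and k: "0 < k"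
  shows "coeff_mat k B =
    - mat s s (\<lambda>(i, j). \<Sum>l<k. (coeff_mat l B * coeff_mat (k - l) F * coeff_mat 0 B) $$ (i, j))"
proof (rule eq_matI)
  let ?b = "\<lambda>l. coeff_mat l B" and ?f = "\<lambda>l. coeff_mat l F"
  have car: "?b l \<in> carrier_mat s s" "?f l \<in> carrier_mat s s" for l using B F by simp_all
  define S where "S = mat s s (\<lambda>(i, j). \<Sum>l<k. (?b l * ?f (k - l)) $$ (i, j))"
  have S: "S \<in> carrier_mat s s" by (simp add: S_def)
  have last: "?b k * ?f 0 = - S"
  proof (rule eq_matI)
    fix i j assume "i < dim_row (- S)" "j < dim_col (- S)"
    then have ij: "i < s" "j < s" using S by auto
    have "0 = (\<Sum>l\<le>k. (?b l * ?f (k - l)) $$ (i, j))"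
      using coeff_mult_index[OF B F ij, of k] BF ij k by (cases "i = j") simp_all
    also have "\<dots> = S $$ (i, j) + (?b k * ?f 0) $$ (i, j)"
      using ij by (simp add: S_def lessThan_Suc_atMost[symmetric] del: index_mult_mat)
    finally show "(?b k * ?f 0) $$ (i, j) = (- S) $$ (i, j)"
      using ij S by (simp add: eq_neg_iff_add_eq_0 add.commute del: index_mult_mat)
  qed (use S car in auto)
  fix i j
  assume "i < dim_row (- mat s s (\<lambda>(i, j). \<Sum>l<k. (?b l * ?f (k - l) * ?b 0) $$ (i, j)))"
    "j < dim_col (- mat s s (\<lambda>(i, j). \<Sum>l<k. (?b l * ?f (k - l) * ?b 0) $$ (i, j)))"
  then have ij: "i < s" "j < s" by simp_all
  have "?b k = ?b k * (?f 0 * ?b 0)"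
    by (simp only: coeff_mat_inverse_0[OF F B FB] right_mult_one_mat[OF car(1)])
  also have "\<dots> = ?b k * ?f 0 * ?b 0"
    using car by (intro assoc_mult_mat[symmetric])
  finally have "?b k = - S * ?b 0" by (simp only: last)
  then have "?b k $$ (i, j) = (- S * ?b 0) $$ (i, j)" by simp
  also have "\<dots> = (\<Sum>q<s. - (S $$ (i, q) * ?b 0 $$ (q, j)))"
    using S ij car by (simp add: index_mult_mat_sum[of _ s] del: index_mult_mat)
  also have "\<dots> = - (\<Sum>q<s. \<Sum>l<k. (?b l * ?f (k - l)) $$ (i, q) * ?b 0 $$ (q, j))"
    using ij by (simp add: sum_negf S_def sum_distrib_right del: index_mult_mat)
  also have "\<dots> = - (\<Sum>l<k. (?b l * ?f (k - l) * ?b 0) $$ (i, j))"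
  proof -
    have "(?b l * ?f (k - l) * ?b 0) $$ (i, j) = (\<Sum>q<s. (?b l * ?f (k - l)) $$ (i, q) * ?b 0 $$ (q, j))" for l
      by (rule index_mult_mat_sum[OF mult_carrier_mat[OF car] car(1) ij])
    then show ?thesis by (subst sum.swap) simp
  qed
  finally show "?b k $$ (i, j) =
      (- mat s s (\<lambda>(i, j). \<Sum>l<k. (?b l * ?f (k - l) * ?b 0) $$ (i, j))) $$ (i, j)"
    using ij by simp
qed (use B in \<open>auto simp: coeff_mat_def\<close>)

text \<open>A summand costs two matrix products and one addition, hence at most
  \<open>5 * s ^ 3\<close>; the constant 12 adds the 7 from inverting the constant
  coefficient.\<close>

lemma computes_recursive_inverse:
  assumes F: "F \<in> carrier_mat s s" and B: "B \<in> carrier_mat s s"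
    and FB: "F * B = 1\<^sub>m s" and BF: "B * F = 1\<^sub>m s" and s: "1 \<le> s" and N: "1 \<le> N"
  shows "computes (recursive_inverse s N (mat_prefix N F)) (mat_prefix N B)
    (12 * s ^ 3 * N ^ 2) (36 * s * s * N)"
proof -
  let ?b = "\<lambda>l. coeff_mat l B" and ?f = "\<lambda>l. coeff_mat l F"
  have car: "?b l \<in> carrier_mat s s" "?f l \<in> carrier_mat s s" for l using B F by simp_all
  define b0 where "b0 = mat_to_list (?b 0)"
  have cells_b0: "cells b0 \<le> s * s" unfolding b0_def using car by (intro cells_mat_to_list)
  have c_b0: "computes (mat_invM s (mat_prefix N F ! 0)) b0 (7 * s ^ 3) (22 * s * s)"
    using computes_mat_invM[OF car(2,1) coeff_mat_inverse_0[OF F B FB] coeff_mat_inverse_0[OF B F BF] s] N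
    by (simp add: mat_prefix_nth b0_def)
  define pass where "pass = (\<lambda>k X. do {
      S \<leftarrow> loopM (\<lambda>l acc. do {
             T \<leftarrow> mat_mulM s (X ! l) (mat_prefix N F ! (k - l));
             U \<leftarrow> mat_mulM s T b0;
             mat_addM s acc U }) [0..<k] (replicate s (replicate s 0));
      Bk \<leftarrow> mat_negM s S;
      return (X @ [Bk]) })"
  have c_pass: "computes (pass k (mat_prefix k B)) (mat_prefix (Suc k) B) (5 * s ^ 3 * N) (13 * s * s * N)"
    if k: "1 \<le> k" "k < N" for k
  proof -
    define S where "S m = mat s s (\<lambda>(i, j). \<Sum>l<m. (?b l * ?f (k - l) * ?b 0) $$ (i, j))" for m
    have S_car: "S m \<in> carrier_mat s s" for m by (simp add: S_def)
    have cells_S: "cells (mat_to_list (S m)) \<le> s * s" for m by (rule cells_mat_to_list[OF S_car])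
    have S0: "replicate s (replicate s 0) = mat_to_list (S 0)"
      by (auto simp: S_def mat_to_list_def intro!: nth_equalityI)
    have "computes (loopM (\<lambda>l acc. do {
             T \<leftarrow> mat_mulM s (mat_prefix k B ! l) (mat_prefix N F ! (k - l));
             U \<leftarrow> mat_mulM s T b0;
             mat_addM s acc U }) [0..<k] (mat_to_list (S 0)))
        (mat_to_list (S k)) (\<Sum>i=0..<k. 5 * s ^ 3) (s * s + 9 * s * s)"
    proof (rule computes_loopM[where y = "\<lambda>m. mat_to_list (S m)"])
      fix l assume l: "l < k"
      let ?T = "?b l * ?f (k - l)"
      have T: "?T \<in> carrier_mat s s"
        by (rule mult_carrier_mat[OF car])
      have U: "?T * ?b 0 \<in> carrier_mat s s"
        by (rule mult_carrier_mat[OF T car(1)])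
      have "S (Suc l) = S l + ?T * ?b 0"
        by (rule eq_matI)
          (use U carrier_matD[OF car(1)] in \<open>auto simp: S_def simp del: index_mult_mat(1)\<close>)
      then have c_add: "computes (mat_addM s (mat_to_list (S l)) (mat_to_list (?T * ?b 0)))
          (mat_to_list (S (Suc l))) (s * s) (4 * s * s + 1)"
        using computes_mat_addM[OF S_car U] by simp
      have nth: "mat_prefix k B ! l = mat_to_list (?b l)" "mat_prefix N F ! (k - l) = mat_to_list (?f (k - l))"
        using l k by (simp_all add: mat_prefix_nth)
      obtain d where d: "s = Suc d" using s by (cases s) simp_all
      show "computes (do {
             T \<leftarrow> mat_mulM s (mat_prefix k B ! l) (mat_prefix N F ! (k - l));
             U \<leftarrow> mat_mulM s T b0;
             mat_addM s (mat_to_list (S l)) U }) (mat_to_list (S (Suc l))) (5 * s ^ 3) (9 * s * s)"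
        unfolding nth b0_def
        by (rule computes_mono, (rule computes_bind_max computes_mat_mulM[OF car] computes_mat_mulM[OF T car(1)] c_add)+)
          (use cells_mat_to_list[OF T] cells_mat_to_list[OF U] in
            \<open>simp_all add: d power3_eq_cube algebra_simps\<close>)
    qed (use cells_S in simp_all)
    then have c_S: "computes (loopM (\<lambda>l acc. do {
             T \<leftarrow> mat_mulM s (mat_prefix k B ! l) (mat_prefix N F ! (k - l));
             U \<leftarrow> mat_mulM s T b0;
             mat_addM s acc U }) [0..<k] (replicate s (replicate s 0)))
        (mat_to_list (S k)) (5 * s ^ 3 * k) (10 * s * s)"
      unfolding S0 by (auto elim!: computes_mono)
    have "?b k = - S k"
      unfolding S_def using coeff_mat_recursion[OF F B FB BF] k by simp
    then have c_neg: "computes (mat_negM s (mat_to_list (S k))) (mat_to_list (?b k)) (s * s) (4 * s * s + 1)"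
      using computes_mat_negM[OF S_car[of k]] by simp
    have "mat_prefix k B @ [mat_to_list (?b k)] = mat_prefix (Suc k) B"
      by (simp add: mat_prefix_def)
    then have c_ret: "computes (return (mat_prefix k B @ [mat_to_list (?b k)])) (mat_prefix (Suc k) B) 0 (Suc k * (s * s))"
      using cells_mat_prefix[OF B, of "Suc k"] by (simp add: computes_return)
    obtain d where d: "s = Suc d" using s by (cases s) simp_all
    \<comment> \<open>The strict inequality \<open>k < N\<close> makes room for the
      \<open>s * s\<close> operations of the negation: only \<open>k\<close> summands are computed,
      while the bound allows for \<open>N\<close>.\<close>
    obtain e where e: "N = Suc (k + e)" using less_imp_Suc_add[OF k(2)] by blast
    obtain f where f: "k = Suc f" using k by (cases k) simp_all
    show ?thesis
      unfolding pass_def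
      by (rule computes_mono, (rule computes_bind_max c_S c_neg c_ret)+)
        (use cells_S[of k] cells_mat_to_list[OF car(1), of k] in
          \<open>simp_all add: d e f power3_eq_cube algebra_simps\<close>)
  qed
  have "computes (loopM pass [1..<N] (mat_prefix 1 B)) (mat_prefix N B)
      (\<Sum>i=1..<N. 5 * s ^ 3 * N) (s * s * N + 13 * s * s * N)"
  proof (rule computes_loopM[where y = "\<lambda>k. mat_prefix k B"])
    fix k assume "k \<le> N"
    then show "cells (mat_prefix k B) \<le> s * s * N"
      by (rule cells_mat_prefix_le[OF B])
  qed (use N c_pass in auto)
  then have c_loop: "computes (loopM pass [1..<N] [b0]) (mat_prefix N B)
      (5 * s ^ 3 * (N * N)) (14 * s * s * N)"
    by (auto simp: mat_prefix_def b0_def elim!: computes_mono)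
  obtain d where d: "s = Suc d" using s by (cases s) simp_all
  obtain e where e: "N = Suc e" using N by (cases N) simp_all
  show ?thesis
    unfolding recursive_inverse_def
    by (rule computes_mono, rule computes_bind_max, rule c_b0, rule c_loop[unfolded pass_def])
      (use cells_b0 in \<open>simp_all add: d e power3_eq_cube power2_eq_square algebra_simps\<close>)
qed

section \<open>Newton inversion\<close>

text \<open>Transforms are spent on \<open>s * s\<close> entries only, three per entry with
  \<open>2 * k * 2 ^ k\<close> operations each, whereas the cubic matrix products occur once per
  frequency. This separates the logarithm from \<open>s ^ 3\<close>.\<close>

lemma computes_mat_series_mulM_exp:
  assumes m: "1 \<le> m" and s: "1 \<le> s" and len: "length X \<le> m" "length Y \<le> m"
  defines "k \<equiv> fft_exp m"
  shows "computes (mat_series_mulM s m X Y) (mat_prefix m (list_series s X * list_series s Y))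
    ((s * s * (6 * k + 2) + 2 * s ^ 3) * 2 ^ k) (16 * s * s * 2 ^ k)"
proof -
  define L :: nat where "L = 2 ^ k"
  have L1: "1 \<le> L" by (simp add: L_def)
  have mL: "m \<le> L" using fft_exp_ge[of m] m by (simp add: L_def k_def)
  define z where "z n = fft_root (- 1) k ^ n" for n
  define G where "G p = map (\<lambda>n. poly p (z n)) [0..<L]" for p
  have len_G: "length (G p) = L" for p by (simp add: G_def)
  define pol where "pol X i j = Poly (map (\<lambda>M. M ! i ! j) X)" for X :: "complex list list list" and i j
  have c_pad: "computes (mapM (\<lambda>i. mapM (\<lambda>j. padded_fft k (map (\<lambda>M. M ! i ! j) X)) [0..<s]) [0..<s])
      (map (\<lambda>i. map (\<lambda>j. G (pol X i j)) [0..<s]) [0..<s]) (s * s * (2 * k * L)) (4 * s * s * L + 9 * L)"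
    if "length X \<le> m" for X
  proof (rule computes_mapM2)
    show "computes (padded_fft k (map (\<lambda>M. M ! i ! j) X)) (G (pol X i j)) (2 * k * L) (9 * L)" for i j
      unfolding G_def z_def pol_def L_def
      by (rule computes_padded_fft) (use that mL in \<open>simp add: L_def\<close>)
  qed (simp add: len_G)
  have cells_G: "cells (map (\<lambda>i. map (\<lambda>j. G (pol X i j)) [0..<s]) [0..<s]) \<le> s * (s * L)" for X
    by (rule cells_map2_le) (simp add: len_G)
  define val where "val X n = mat s s (\<lambda>(i, j). poly (pol X i j) (z n))" for X n
  have val: "val X n \<in> carrier_mat s s" for X n by (simp add: val_def)
  have val_eq: "map (map (\<lambda>xs. xs ! n)) (map (\<lambda>i. map (\<lambda>j. G (pol X i j)) [0..<s]) [0..<s]) =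
      mat_to_list (val X n)" if "n < L" for X n
    using that by (simp add: val_def mat_to_list_carrier[of _ s s] G_def)
  let ?fX = "map (\<lambda>i. map (\<lambda>j. G (pol X i j)) [0..<s]) [0..<s]"
  let ?fY = "map (\<lambda>i. map (\<lambda>j. G (pol Y i j)) [0..<s]) [0..<s]"
  define fZ where "fZ = map (\<lambda>n. mat_to_list (val X n * val Y n)) [0..<L]"
  have prod: "val X n * val Y n \<in> carrier_mat s s" for n
    using val by (intro mult_carrier_mat)
  have c_Z: "computes (mapM (\<lambda>f. mat_mulM s (map (map (\<lambda>xs. xs ! f)) ?fX) (map (map (\<lambda>xs. xs ! f)) ?fY)) [0..<L])
      fZ (L * (2 * s ^ 3)) (2 * L * (s * s) + (4 * s * s + 3))"
  proof -
    have "computes (mapM (\<lambda>f. mat_mulM s (map (map (\<lambda>xs. xs ! f)) ?fX) (map (map (\<lambda>xs. xs ! f)) ?fY)) [0..<L])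
      fZ (length [0..<L] * (2 * s ^ 3)) (2 * length [0..<L] * (s * s) + (4 * s * s + 3))"
      unfolding fZ_def
    proof (rule computes_mapM)
      fix f assume "f \<in> set [0..<L]"
      then have "f < L" by simp
      show "computes (mat_mulM s (map (map (\<lambda>xs. xs ! f)) ?fX) (map (map (\<lambda>xs. xs ! f)) ?fY))
          (mat_to_list (val X f * val Y f)) (2 * s ^ 3) (4 * s * s + 3)"
        unfolding val_eq[OF \<open>f < L\<close>] by (rule computes_mat_mulM[OF val val])
      show "cells (mat_to_list (val X f * val Y f)) \<le> s * s"
        by (rule cells_mat_to_list[OF prod])
    qed
    then show ?thesis by simp
  qed
  have cells_fZ: "cells fZ \<le> L * (s * s)"
    using cells_map_le[of "[0..<L]" "\<lambda>n. mat_to_list (val X n * val Y n)" "s * s"]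
      cells_mat_to_list[OF prod] by (simp add: fZ_def)
  \<comment> \<open>The entry of the matrix product over the polynomial ring. Evaluation is a ring
    homomorphism, so its values are the corresponding entries of the scalar products, one per
    frequency.\<close>
  define pz where "pz i j = (\<Sum>q<s. pol X i q * pol Y q j)" for i j
  have fZ_eq: "map (\<lambda>M. M ! i ! j) fZ = G (pz i j)" if "i < s" "j < s" for i j
  proof -
    have "(val X n * val Y n) $$ (i, j) = poly (pz i j) (z n)" for n
      unfolding index_mult_mat_sum[OF val val that] using that by (simp add: val_def pz_def poly_sum)
    then show ?thesis
      using that prod by (simp add: fZ_def G_def mat_to_list_nth[of _ s s] del: index_mult_mat)
  qed
  have deg: "degree (pz i j) < 2 ^ k" for i j
    unfolding pz_def k_def
  proof (rule degree_sum_less)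
    show "degree (pol X i q * pol Y q j) < 2 ^ fft_exp m" for q
      unfolding pol_def by (rule degree_Poly_mult_less[OF m]) (use len in simp_all)
  qed simp
  define Z where "Z = map (\<lambda>i. map (\<lambda>j. map (coeff (pz i j)) [0..<m]) [0..<s]) [0..<s]"
  have c_inv: "computes (mapM (\<lambda>i. mapM (\<lambda>j. do {
           zs \<leftarrow> inverse_fft k (map (\<lambda>M. M ! i ! j) fZ);
           return (take m zs) }) [0..<s]) [0..<s]) Z (s * s * (2 * k * L + L + 1)) (4 * s * s * m + 8 * L)"
    unfolding Z_def
  proof (rule computes_mapM2)
    fix i j assume ij: "i < s" "j < s"
    have c: "computes (inverse_fft k (G (pz i j))) (map (coeff (pz i j)) [0..<L]) (2 * k * L + L + 1) (8 * L)"
      unfolding G_def z_def L_def by (rule computes_inverse_fft[OF deg])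
    have "take m (map (coeff (pz i j)) [0..<L]) = map (coeff (pz i j)) [0..<m]"
      using mL by (simp add: take_map)
    then have r: "computes (return (take m (map (coeff (pz i j)) [0..<L]))) (map (coeff (pz i j)) [0..<m]) 0 m"
      by (simp add: computes_return)
    show "computes (inverse_fft k (map (\<lambda>M. M ! i ! j) fZ) \<bind> (\<lambda>zs. return (take m zs)))
        (map (coeff (pz i j)) [0..<m]) (2 * k * L + L + 1) (8 * L)"
      unfolding fZ_eq[OF ij] by (rule computes_mono, rule computes_bind_max, rule c, rule r) (use mL in simp_all)
  qed simp
  have cells_Z: "cells Z \<le> s * (s * m)"
    unfolding Z_def by (rule cells_map2_le) simp
  have "fps_of_poly (pz i j) = (list_series s X * list_series s Y) $$ (i, j)" if "i < s" "j < s" for i j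
    using that
    by (simp add: index_mult_mat_sum[of _ s] pz_def fps_of_poly_sum fps_of_poly_mult list_series_def
        series_def pol_def del: index_mult_mat)
  then have coeff: "coeff (pz i j) l = (list_series s X * list_series s Y) $$ (i, j) $ l"
    if "i < s" "j < s" for i j l
    using that by (metis fps_of_poly_nth)
  have LXY: "list_series s X * list_series s Y \<in> carrier_mat s s"
    by (rule mult_carrier_mat[OF list_series_carrier list_series_carrier])
  have "map (\<lambda>k. map (map (\<lambda>zs. zs ! k)) Z) [0..<m] = mat_prefix m (list_series s X * list_series s Y)"
    unfolding mat_prefix_def mat_to_list_carrier[OF coeff_mat_carrier[OF LXY]]
    by (simp add: Z_def coeff coeff_mat_index[OF LXY] del: index_mult_mat)
  then have c_ret: "computes (return (map (\<lambda>k. map (map (\<lambda>zs. zs ! k)) Z) [0..<m]))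
      (mat_prefix m (list_series s X * list_series s Y)) 0 (m * (s * s))"
    using cells_mat_prefix[OF LXY] by (simp add: computes_return)
  obtain d where d: "s = Suc d" using s by (cases s) simp_all
  obtain e where e: "L = m + e" using mL le_Suc_ex by blast
  obtain f where f: "m = Suc f" using m by (cases m) simp_all
  show ?thesis
    unfolding mat_series_mulM_def k_def[symmetric] L_def[symmetric]
    by (rule computes_mono, (rule computes_bind_max c_pad[OF len(1)] c_pad[OF len(2)] c_Z c_inv c_ret)+)
      (use cells_G[of X] cells_G[of Y] cells_fZ cells_Z in
        \<open>simp_all only: nat_add_max_right max.bounded_iff, simp_all add: d e f power3_eq_cube algebra_simps\<close>)
qed

lemma computes_mat_series_mulM:
  assumes m: "1 \<le> m" "m \<le> N" and s: "1 \<le> s" and len: "length X \<le> m" "length Y \<le> m"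
  shows "computes (mat_series_mulM s m X Y) (mat_prefix m (list_series s X * list_series s Y))
    ((s * s * (24 * fft_exp N + 8) + 8 * s ^ 3) * m) (64 * s * s * m)"
proof (rule computes_mono[OF computes_mat_series_mulM_exp[OF m(1) s len]])
  have "(s * s * (6 * fft_exp m + 2) + 2 * s ^ 3) * 2 ^ fft_exp m \<le>
      (s * s * (6 * fft_exp N + 2) + 2 * s ^ 3) * (4 * m)"
    by (intro mult_mono add_mono fft_exp_mono fft_exp_le order_refl m) simp_all
  then show "(s * s * (6 * fft_exp m + 2) + 2 * s ^ 3) * 2 ^ fft_exp m \<le>
      (s * s * (24 * fft_exp N + 8) + 8 * s ^ 3) * m"
    by (simp add: algebra_simps)
  have "16 * s * s * 2 ^ fft_exp m \<le> 16 * s * s * (4 * m)"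
    by (rule mult_left_mono[OF fft_exp_le[OF m(1)]]) simp
  then show "16 * s * s * 2 ^ fft_exp m \<le> 64 * s * s * m" by simp
qed

text \<open>Matrices of size \<open>s\<close> have no numeral \<open>2\<close>, so
  \<open>2 - F * b\<close> appears as \<open>1 + (1 - F * b)\<close>. As the ring is not
  commutative, both inverse laws are used: \<open>B * F = 1\<close> collapses
  \<open>B * (F * b)\<close>, and \<open>F * B = 1\<close> simplifies
  \<open>F * (B - b)\<close>.\<close>

lemma mat_newton_identity:
  fixes F B b :: "complex fps mat"
  assumes F: "F \<in> carrier_mat s s" and B: "B \<in> carrier_mat s s" and b: "b \<in> carrier_mat s s"
    and FB: "F * B = 1\<^sub>m s" and BF: "B * F = 1\<^sub>m s"
  shows "b * (1\<^sub>m s + (1\<^sub>m s - F * b)) = B - (B - b) * (F * (B - b))"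
proof -
  have [simp]: "F * b \<in> carrier_mat s s" "b * (F * b) \<in> carrier_mat s s"
    using F b by (intro mult_carrier_mat; simp)+
  have "B * (F * b) = b"
    using assoc_mult_mat[OF B F b] BF b by simp
  moreover have "F * (B - b) = 1\<^sub>m s - F * b"
    using mult_minus_distrib_mat[OF F B b] FB by simp
  moreover have "(B - b) * (1\<^sub>m s - F * b) = (B - b) - (B - b) * (F * b)"
    using mult_minus_distrib_mat[of "B - b" s s "1\<^sub>m s" s "F * b"] B b
    by (simp add: minus_carrier_mat)
  moreover have "(B - b) * (F * b) = B * (F * b) - b * (F * b)"
    using minus_mult_distrib_mat[OF B b, of "F * b" s] by simp
  ultimately have rhs: "(B - b) * (F * (B - b)) = (B - b) - (b - b * (F * b))"
    by simp
  have "b * (1\<^sub>m s + (1\<^sub>m s - F * b)) = b * 1\<^sub>m s + b * (1\<^sub>m s - F * b)"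
    using b by (intro mult_add_distrib_mat) (auto intro: minus_carrier_mat)
  also have "b * (1\<^sub>m s - F * b) = b * 1\<^sub>m s - b * (F * b)"
    using b by (intro mult_minus_distrib_mat) auto
  finally show ?thesis
    unfolding rhs using B b \<open>b * (F * b) \<in> carrier_mat s s\<close>
    by (intro eq_matI) (auto simp del: index_mult_mat(1))
qed

lemma mat_newton_step:
  assumes F: "F \<in> carrier_mat s s" and B: "B \<in> carrier_mat s s" and b: "b \<in> carrier_mat s s"
    and FB: "F * B = 1\<^sub>m s" and BF: "B * F = 1\<^sub>m s" and cong: "mat_cong s n b B"
  shows "mat_cong s (2 * n) (b * (1\<^sub>m s + (1\<^sub>m s - F * b))) B"
  unfolding mat_cong_def
proof (intro allI impI)
  fix i j assume ij: "i < s" "j < s"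
  define D where "D = B - b"
  have D: "D \<in> carrier_mat s s" using b by (simp add: D_def minus_carrier_mat)
  have FD: "F * D \<in> carrier_mat s s" using F D by simp
  have D0: "fps_cong n (D $$ (i, j)) 0" if "i < s" "j < s" for i j
    using cong that B b by (auto simp: D_def mat_cong_def fps_cong_def)
  have FD0: "fps_cong n ((F * D) $$ (i, j)) 0" if "i < s" "j < s" for i j
  proof -
    have "fps_cong n ((F * D) $$ (i, j)) (\<Sum>q<s. F $$ (i, q) * 0)"
      unfolding index_mult_mat_sum[OF F D that]
      by (intro fps_cong_sum fps_cong_mult fps_cong_refl D0 that) simp
    then show ?thesis by simp
  qed
  \<comment> \<open>Each summand is a product of two series that vanish below order
    \<open>n\<close>.\<close>
  have "(D * (F * D)) $$ (i, j) $ l = 0" if "l < 2 * n" for l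
    unfolding index_mult_mat_sum[OF D FD ij] fps_sum_nth
    by (rule sum.neutral) (use D0 FD0 ij that in \<open>auto intro!: fps_mult_nth_eq_0[of n _ n]\<close>)
  moreover have "D * (F * D) \<in> carrier_mat s s" using D FD by simp
  ultimately show "fps_cong (2 * n) ((b * (1\<^sub>m s + (1\<^sub>m s - F * b))) $$ (i, j)) (B $$ (i, j))"
    unfolding mat_newton_identity[OF F B b FB BF] D_def[symmetric]
    using B D ij by (simp add: fps_cong_def del: index_mult_mat(1))
qed

text \<open>Four times the cost \<open>T\<close> per coefficient gives
  \<open>192 * fft_exp N + 68\<close> and \<open>64 * s ^ 3\<close>; inverting the constant
  coefficient adds \<open>7 * s ^ 3\<close>, hence 71.\<close>

lemma computes_newton_inverse:
  assumes F: "F \<in> carrier_mat s s" and B: "B \<in> carrier_mat s s"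
    and FB: "F * B = 1\<^sub>m s" and BF: "B * F = 1\<^sub>m s" and s: "1 \<le> s" and N: "1 \<le> N"
  shows "computes (newton_inverse s N (mat_prefix N F)) (mat_prefix N B)
    (s * s * N * (192 * fft_exp N + 68) + 71 * s ^ 3 * N) (100 * s * s * N)"
proof -
  have car: "coeff_mat l B \<in> carrier_mat s s" "coeff_mat l F \<in> carrier_mat s s" for l using B F by simp_all
  define b0 where "b0 = mat_to_list (coeff_mat 0 B)"
  have cells_b0: "cells b0 \<le> s * s" unfolding b0_def using car by (intro cells_mat_to_list)
  have c_b0: "computes (mat_invM s (mat_prefix N F ! 0)) b0 (7 * s ^ 3) (22 * s * s)"
    using computes_mat_invM[OF car(2,1) coeff_mat_inverse_0[OF F B FB] coeff_mat_inverse_0[OF B F BF] s] N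
    by (simp add: mat_prefix_nth b0_def)
  define K where "K = fft_exp N"
  \<comment> \<open>Per coefficient: two products of matrix series and \<open>s * s\<close>
    subtractions.\<close>
  define T where "T = s * s * (48 * K + 17) + 16 * s ^ 3"
  define y where "y r = mat_prefix (min (2 ^ r) N) B" for r
  define pass where "pass = (\<lambda>r X. let m = min (2 ^ Suc r) N in do {
      T \<leftarrow> mat_series_mulM s m (take m (mat_prefix N F)) X;
      U \<leftarrow> mapM (\<lambda>k. mapM (\<lambda>i. mapM (\<lambda>j.
             subM (if k = 0 \<and> i = j then 2 else 0) (T ! k ! i ! j)) [0..<s]) [0..<s]) [0..<m];
      mat_series_mulM s m X U })"
  obtain d where d: "s = Suc d" using s by (cases s) simp_all
  obtain e where e: "N = Suc e" using N by (cases N) simp_all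
  have c_pass: "computes (pass r (y r)) (y (Suc r)) (T * 2 ^ Suc r) (80 * s * s * N)" for r
  proof -
    define m where "m = min (2 ^ Suc r) N"
    define n where "n = min (2 ^ r) N"
    have mn: "1 \<le> m" "m \<le> N" "n \<le> m" "m \<le> 2 * n" "m \<le> 2 ^ Suc r"
      using N by (auto simp: m_def n_def min_def)
    define b where "b = list_series s (y r)"
    define F' where "F' = list_series s (mat_prefix m F)"
    have b: "b \<in> carrier_mat s s" and F': "F' \<in> carrier_mat s s" by (simp_all add: b_def F'_def)
    have F'b: "F' * b \<in> carrier_mat s s" and Fb: "F * b \<in> carrier_mat s s" using F F' b by simp_all
    define T' where "T' = mat_prefix m (F' * b)"
    have c_T: "computes (mat_series_mulM s m (mat_prefix m F) (y r)) T'
        ((s * s * (24 * K + 8) + 8 * s ^ 3) * m) (64 * s * s * m)"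
      unfolding T'_def F'_def b_def K_def
      by (rule computes_mat_series_mulM) (use mn s in \<open>simp_all add: y_def n_def\<close>)
    have cells_T: "cells T' \<le> m * (s * s)"
      unfolding T'_def by (rule cells_mat_prefix[OF F'b])
    define E where "E = 1\<^sub>m s + (1\<^sub>m s - F' * b)"
    have E: "E \<in> carrier_mat s s" by (simp add: E_def F'b minus_carrier_mat)
    have c_U: "computes (mapM (\<lambda>k. mapM (\<lambda>i. mapM (\<lambda>j.
             subM (if k = 0 \<and> i = j then 2 else 0) (T' ! k ! i ! j)) [0..<s]) [0..<s]) [0..<m])
        (mat_prefix m E) (m * (s * s)) (2 * m * (s * s) + (4 * s * s + 1))"
    proof -
      have "computes (mapM (\<lambda>k. mapM (\<lambda>i. mapM (\<lambda>j.
             subM (if k = 0 \<and> i = j then 2 else 0) (T' ! k ! i ! j)) [0..<s]) [0..<s]) [0..<m])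
        (mat_prefix m E) (length [0..<m] * (s * s * 1)) (2 * length [0..<m] * (s * s) + (4 * s * s + 1))"
        unfolding mat_prefix_def
      proof (rule computes_mapM)
        fix k assume "k \<in> set [0..<m]"
        then have k: "k < m" by simp
        show "computes (mapM (\<lambda>i. mapM (\<lambda>j.
             subM (if k = 0 \<and> i = j then 2 else 0) (T' ! k ! i ! j)) [0..<s]) [0..<s])
          (mat_to_list (coeff_mat k E)) (s * s * 1) (4 * s * s + 1)"
        proof (rule computes_mat)
          fix i j assume ij: "i < s" "j < s"
          have "T' ! k ! i ! j = (F' * b) $$ (i, j) $ k"
            using k ij F'b by (simp add: T'_def mat_prefix_nth mat_to_list_nth[of _ s s]
                coeff_mat_index[of _ s s] del: index_mult_mat(1))
          \<comment> \<open>The identity over the power series has its ones in coefficient 0 only,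
            so \<open>1 + 1\<close> yields exactly the \<open>2\<close> that the program
            inserts.\<close>
          then have "coeff_mat k E $$ (i, j) = (if k = 0 \<and> i = j then 2 else 0) - T' ! k ! i ! j"
            using ij F' b unfolding coeff_mat_index[OF E ij]
            by (auto simp: E_def numeral_fps_const simp del: index_mult_mat(1))
          then show "computes (subM (if k = 0 \<and> i = j then 2 else 0) (T' ! k ! i ! j))
              (coeff_mat k E $$ (i, j)) 1 1"
            by (simp only: computes_arith)
        qed (simp add: E)
        show "cells (mat_to_list (coeff_mat k E)) \<le> s * s"
          by (rule cells_mat_to_list) (simp add: E)
      qed
      then show ?thesis by simp
    qed
    have cells_U: "cells (mat_prefix m E) \<le> m * (s * s)"
      by (rule cells_mat_prefix[OF E])
    let ?U = "list_series s (mat_prefix m E)"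
    have c_V: "computes (mat_series_mulM s m (y r) (mat_prefix m E)) (mat_prefix m (b * ?U))
        ((s * s * (24 * K + 8) + 8 * s ^ 3) * m) (64 * s * s * m)"
      unfolding b_def K_def
      by (rule computes_mat_series_mulM) (use mn s in \<open>simp_all add: y_def n_def\<close>)
    \<comment> \<open>\<open>E'\<close> is the Newton factor for the exact \<open>F\<close>; the
      program works with the truncation \<open>F'\<close> and obtains \<open>E\<close>, which agrees
      with it modulo \<open>x^m\<close>.\<close>
    define E' where "E' = 1\<^sub>m s + (1\<^sub>m s - F * b)"
    have E': "E' \<in> carrier_mat s s" by (simp add: E'_def Fb minus_carrier_mat)
    have "mat_cong s m (F' * b) (F * b)"
      unfolding F'_def by (rule mat_cong_mult[OF list_series_carrier F b b list_series_prefix[OF F] mat_cong_refl])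
    then have "mat_cong s m E E'"
      using F F' b by (auto simp: mat_cong_def E_def E'_def fps_cong_def simp del: index_mult_mat(1))
    then have "mat_cong s m ?U E'"
      using list_series_prefix[OF E] mat_cong_trans by blast
    then have "mat_cong s m (b * ?U) (b * E')"
      by (intro mat_cong_mult b E' list_series_carrier mat_cong_refl)
    also have "mat_cong s m (b * E') B"
    proof -
      have "mat_cong s n b B"
        unfolding b_def y_def n_def by (rule list_series_prefix[OF B])
      from mat_newton_step[OF F B b FB BF this] mn(4) show ?thesis
        unfolding E'_def by (simp add: mat_cong_def fps_cong_def del: index_mult_mat(1))
    qed
    finally have "mat_prefix m (b * ?U) = mat_prefix m B"
      by (intro mat_prefix_cong[OF _ B] mult_carrier_mat[OF b list_series_carrier])
    then have res: "mat_prefix m (b * ?U) = y (Suc r)"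
      by (simp add: y_def m_def)
    note c_V = c_V[unfolded res]
    obtain f where f: "m = Suc f" using mn(1) by (cases m) simp_all
    have "computes (pass r (y r)) (y (Suc r)) (T * m) (80 * s * s * m)"
      unfolding pass_def Let_def m_def[symmetric] take_mat_prefix[OF mn(2)]
      by (rule computes_mono, (rule computes_bind_max c_T c_U c_V)+)
        (use cells_T cells_U in \<open>simp_all add: T_def d f algebra_simps\<close>)
    then show ?thesis
      by (rule computes_mono) (use mn in auto)
  qed
  have c_loop: "computes (loopM pass [0..<ceillog2 N] (y 0)) (y (ceillog2 N))
      (\<Sum>r=0..<ceillog2 N. T * 2 ^ Suc r) (s * s * N + 80 * s * s * N)"
  proof (rule computes_loopM[where y = y])
    show "cells (y r) \<le> s * s * N" for r
      unfolding y_def by (rule cells_mat_prefix_le[OF B]) simp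
  qed (use c_pass in simp_all)
  have y0: "y 0 = [b0]" using N by (simp add: y_def mat_prefix_def b0_def)
  have yR: "y (ceillog2 N) = mat_prefix N B"
    using le_two_power_ceillog2[of N] by (simp add: y_def min_def)
  have "computes (loopM pass [0..<ceillog2 N] [b0]) (mat_prefix N B) (T * (4 * N)) (81 * s * s * N)"
    by (rule computes_mono[OF c_loop[unfolded y0 yR] sum_two_power_le]) (use N in simp_all)
  note c_loop = this[unfolded pass_def]
  show ?thesis
    unfolding newton_inverse_def K_def[symmetric]
    by (rule computes_mono, rule computes_bind_max, rule c_b0, rule c_loop)
      (use cells_b0 in \<open>simp_all add: T_def d e power3_eq_cube algebra_simps\<close>)
qed

section \<open>Gauss--Jordan elimination\<close>

lemma computes_series_subM:
  fixes xs ys :: "complex list"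
  assumes "length xs = N" "length ys = N"
  shows "computes (series_subM N xs ys) (prefix N (series xs - series ys)) N (2 * N + 1)"
proof -
  have "computes (series_subM N xs ys) (map (\<lambda>k. xs ! k - ys ! k) [0..<N])
      (length [0..<N] * 1) (2 * length [0..<N] * 1 + 1)"
    unfolding series_subM_def by (rule computes_mapM[OF computes_arith(2)]) simp
  moreover have "map (\<lambda>k. xs ! k - ys ! k) [0..<N] = prefix N (series xs - series ys)"
    using assms by (simp add: prefix_def series_nth)
  ultimately show ?thesis by simp
qed

text \<open>The common cost is that of inversion, \<open>4 * (48 * fft_exp N + 26) * N\<close>,
  which dominates product and subtraction.\<close>

lemma series_arithmetic_lists:
  assumes N: "1 \<le> N"
  shows "series_arithmetic (series_invM N) (series_mulM N) (series_subM N) series (\<lambda>x. length x = N) N N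
    ((192 * fft_exp N + 104) * N) (100 * N)"
proof
  fix x y :: "complex list" assume x: "length x = N"
  {
    assume "series x $ 0 \<noteq> 0"
    then have "x ! 0 \<noteq> 0" by (auto simp: series_nth split: if_splits)
    then have c: "computes (series_invM N x) (prefix N (inverse (series x)))
        (4 * (48 * fft_exp N + 26) * N) (100 * N)"
      by (rule computes_series_invM[OF N x])
    then have r: "result (series_invM N x) = prefix N (inverse (series x))"
      by (simp add: computes_def)
    have "fps_cong N (series (prefix N (inverse (series x))) * series x) (inverse (series x) * series x)"
      by (intro fps_cong_mult fps_cong_series_prefix fps_cong_refl)
    also have "inverse (series x) * series x = 1"
      using \<open>series x $ 0 \<noteq> 0\<close> by (rule inverse_mult_eq_1)
    finally show "length (result (series_invM N x)) = N \<and>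
        computes (series_invM N x) (result (series_invM N x)) ((192 * fft_exp N + 104) * N) (100 * N) \<and>
        fps_cong N (series (result (series_invM N x)) * series x) 1"
      unfolding r using c by (simp add: algebra_simps)
  }
  assume y: "length y = N"
  have c: "computes (series_mulM N x y) (prefix N (series x * series y)) ((24 * fft_exp N + 12) * N) (44 * N)"
    by (rule computes_series_mulM) (use N x y in simp_all)
  then have r: "result (series_mulM N x y) = prefix N (series x * series y)"
    by (simp add: computes_def)
  show "length (result (series_mulM N x y)) = N \<and>
      computes (series_mulM N x y) (result (series_mulM N x y)) ((192 * fft_exp N + 104) * N) (100 * N) \<and>
      fps_cong N (series (result (series_mulM N x y))) (series x * series y)"
    unfolding r using computes_mono[OF c] fps_cong_series_prefix by simp
  have c: "computes (series_subM N x y) (prefix N (series x - series y)) N (2 * N + 1)"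
    by (rule computes_series_subM[OF x y])
  then have r: "result (series_subM N x y) = prefix N (series x - series y)"
    by (simp add: computes_def)
  show "length (result (series_subM N x y)) = N \<and>
      computes (series_subM N x y) (result (series_subM N x y)) ((192 * fft_exp N + 104) * N) (100 * N) \<and>
      fps_cong N (series (result (series_subM N x y))) (series x - series y)"
    unfolding r using computes_mono[OF c] fps_cong_series_prefix N by simp
qed (use N in simp_all)

text \<open>Storage adds the augmented matrix, \<open>2 * s * s * N\<close>, to the
  \<open>18 * s * s * N + 100 * N\<close> of the elimination.\<close>

lemma computes_gauss_jordan_inverse:
  assumes F: "F \<in> carrier_mat s s" and B: "B \<in> carrier_mat s s"
    and FB: "F * B = 1\<^sub>m s" and BF: "B * F = 1\<^sub>m s" and s: "1 \<le> s" and N: "1 \<le> N"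
    and pv: "pivot_rule (\<lambda>a. a ! 0 \<noteq> 0) pv"
  shows "computes (gauss_jordan_inverse pv s N (mat_prefix N F)) (mat_prefix N B)
    (7 * s ^ 3 * ((192 * fft_exp N + 104) * N)) (130 * s * s * N)"
proof -
  interpret series_arithmetic "series_invM N" "series_mulM N" "series_subM N" series
    "\<lambda>x. length x = N" N N "(192 * fft_exp N + 104) * N" "100 * N"
    by (rule series_arithmetic_lists[OF N])
  define W where "W = map (\<lambda>i.
           map (\<lambda>j. map (\<lambda>M. M ! i ! j) (mat_prefix N F)) [0..<s] @
           map (\<lambda>j. pad N [if i = j then 1 else 0]) [0..<s]) [0..<s]"
  have left: "W ! r ! j = map (\<lambda>M. M ! r ! j) (mat_prefix N F)" if "r < s" "j < s" for r j
    using that by (simp add: W_def nth_append)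
  have right: "W ! r ! (s + k) = pad N [if r = k then 1 else 0]" if "r < s" "k < s" for r k
    using that by (simp add: W_def nth_append)
  have wf: "wf_mat s W"
    using N by (auto simp: wf_mat_def W_def nth_append pad_def)
  have inv: "gj_inv N s (\<lambda>k j. F $$ (k, j)) 0 (\<lambda>r j. series (W ! r ! j))"
  proof (rule gj_inv_init[OF F B BF N])
    fix r j assume rj: "r < s" "j < s"
    then show "fps_cong N (series (W ! r ! j)) (F $$ (r, j))"
      using F by (simp add: left fps_cong_def series_nth mat_prefix_nth mat_to_list_nth[of _ s s] coeff_mat_index)
    have "series (pad N [c]) = fps_const c" for c :: complex
      using N by (auto simp: fps_eq_iff series_nth pad_def nth_Cons split: nat.split)
    then show "series (W ! r ! (s + j)) = (if r = j then 1 else 0)"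
      using rj by (simp add: right)
  qed
  obtain V where V: "wf_mat s V" "gj_inv N s (\<lambda>k j. F $$ (k, j)) s (\<lambda>r j. series (V ! r ! j))"
    "computes (Defs.gauss_jordan (series_invM N) (series_mulM N) (series_subM N) pv s W) V
      (7 * s ^ 3 * ((192 * fft_exp N + 104) * N)) (18 * s * s * N + 100 * N)"
    \<comment> \<open>For a list of length \<open>N >= 1\<close> the entry at 0 is the constant
      coefficient of its series, so the pivot test on lists is the one that the elimination
      expects.\<close>
    using computes_gauss_jordan[OF wf inv pv] N by (auto simp: series_nth)
  have "V ! r ! (s + j) ! k = B $$ (r, j) $ k" if "r < s" "j < s" "k < N" for r j k
    using gj_inv_result[OF F B FB V(2) that(1,2)] that V(1) by (simp add: fps_cong_def series_nth wf_mat_def)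
  moreover have len: "length V = s" using V(1) by (simp add: wf_mat_def)
  ultimately have "map (\<lambda>k. map (\<lambda>row. map (\<lambda>j. row ! (s + j) ! k) [0..<s]) V) [0..<N] = mat_prefix N B"
    unfolding mat_prefix_def mat_to_list_carrier[OF coeff_mat_carrier[OF B]]
    by (auto intro!: nth_equalityI simp: coeff_mat_index[OF B])
  then have c_ret: "computes (return (map (\<lambda>k. map (\<lambda>row. map (\<lambda>j. row ! (s + j) ! k) [0..<s]) V) [0..<N]))
      (mat_prefix N B) 0 (N * (s * s))"
    using cells_mat_prefix[OF B, of N] by (simp add: computes_return)
  have c_W: "computes (return W) W 0 (2 * s * s * N)"
    by (rule computes_return[OF wf_mat_cells[OF wf]])
  obtain d where d: "s = Suc d" using s by (cases s) simp_all
  show ?thesis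
    unfolding gauss_jordan_inverse_def W_def[symmetric]
    by (rule computes_mono, (rule computes_bind_max c_W V(3) c_ret)+)
      (use wf_mat_cells[OF wf] wf_mat_cells[OF V(1)] in \<open>simp_all add: d algebra_simps\<close>)
qed

section \<open>Comparison of the three methods\<close>

text \<open>The FFT length is at most \<open>4 * N\<close>, which bounds the exponent by
  \<open>2 + log 2 N\<close>; for \<open>N >= 2\<close> the logarithm is at least 1 and absorbs the
  summand.\<close>

lemma fft_exp_le_log:
  assumes "2 \<le> N"
  shows "real (fft_exp N) \<le> 3 * log 2 (real N)"
proof -
  have "real (2 ^ fft_exp N) \<le> real (4 * N)"
    using fft_exp_le[of N] assms by (subst of_nat_le_iff) simp
  then have "log 2 (2 ^ fft_exp N) \<le> log 2 (4 * real N)"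
    using assms by (subst log_le_cancel_iff) auto
  also have "\<dots> = 2 + log 2 (real N)"
    using assms log_pow_cancel[of 2 2] by (simp add: log_mult)
  finally have "real (fft_exp N) \<le> 2 + log 2 (real N)" by (simp add: log_pow_cancel)
  moreover have "1 \<le> log 2 (real N)"
    using assms by simp
  ultimately show ?thesis by simp
qed

lemma inversion_bounds:
  fixes A :: "nat \<Rightarrow> complex mat"
  assumes s: "1 \<le> s" and N: "2 \<le> N" and A: "\<And>k. A k \<in> carrier_mat s s"
    and inv: "invertible_mat (A 0)" and pv: "pivot_rule (\<lambda>a. a ! 0 \<noteq> 0) pv"
  defines "a \<equiv> Defs.coeffs N A" and "b \<equiv> Defs.coeffs N (conv_inverse s A)"
  shows "result (recursive_inverse s N a) = b" "result (newton_inverse s N a) = b"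
    "result (gauss_jordan_inverse pv s N a) = b"
    "real (ops (recursive_inverse s N a)) \<le> 6000 * (real s ^ 3 * real N ^ 2)"
    "real (ops (newton_inverse s N a)) \<le>
      6000 * (real s ^ 2 * real N * log 2 (real N) + real s ^ 3 * real N)"
    "real (ops (gauss_jordan_inverse pv s N a)) \<le> 6000 * (real s ^ 3 * real N * log 2 (real N))"
    "real (storage a (recursive_inverse s N a)) \<le> 6000 * (real s ^ 2 * real N)"
    "real (storage a (newton_inverse s N a)) \<le> 6000 * (real s ^ 2 * real N)"
    "real (storage a (gauss_jordan_inverse pv s N a)) \<le> 6000 * (real s ^ 2 * real N)"
proof -
  define F where "F = series_mat s A"
  have F: "F \<in> carrier_mat s s" by (simp add: F_def)
  have "invertible_mat (coeff_mat 0 F)" using inv A by (simp add: F_def coeff_series_mat)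
  then obtain B where B: "B \<in> carrier_mat s s" and FB: "F * B = 1\<^sub>m s" and BF: "B * F = 1\<^sub>m s"
    using series_mat_inverse[OF F] by blast
  have a: "a = mat_prefix N F"
    unfolding a_def F_def by (rule coeffs_eq_mat_prefix[OF A])
  have b: "b = mat_prefix N B"
    unfolding b_def conv_inverse_eq[OF A B FB[unfolded F_def] BF[unfolded F_def]]
    by (simp add: Defs.coeffs_def mat_prefix_def)
  have N1: "1 \<le> N" using N by simp
  have cells_a: "cells a \<le> s * s * N"
    unfolding a by (rule cells_mat_prefix_le[OF F order_refl])
  note rec = computes_recursive_inverse[OF F B FB BF s N1, folded a b, unfolded computes_def]
  note newton = computes_newton_inverse[OF F B FB BF s N1, folded a b, unfolded computes_def]
  note gj = computes_gauss_jordan_inverse[OF F B FB BF s N1 pv, folded a b, unfolded computes_def]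
  show "result (recursive_inverse s N a) = b" "result (newton_inverse s N a) = b"
    "result (gauss_jordan_inverse pv s N a) = b"
    using rec newton gj by simp_all
  \<comment> \<open>131 is the 130 of Gauss-Jordan elimination, the largest of the three peaks, plus
    1 for the input.\<close>
  have storage: "real n \<le> 6000 * (real s ^ 2 * real N)" if "n \<le> 131 * (s * s * N)" for n
  proof -
    have "real n \<le> real (131 * (s * s * N))" using that by (rule of_nat_mono)
    also have "\<dots> = 131 * (real s ^ 2 * real N)" by (simp add: power2_eq_square)
    also have "\<dots> \<le> 6000 * (real s ^ 2 * real N)" by (rule mult_right_mono) simp_all
    finally show ?thesis .
  qed
  show "real (storage a (recursive_inverse s N a)) \<le> 6000 * (real s ^ 2 * real N)"
    "real (storage a (newton_inverse s N a)) \<le> 6000 * (real s ^ 2 * real N)"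
    "real (storage a (gauss_jordan_inverse pv s N a)) \<le> 6000 * (real s ^ 2 * real N)"
    by (rule storage, use cells_a rec newton gj in \<open>simp add: storage_def\<close>)+
  define lg where "lg = log 2 (real N)"
  have lg: "1 \<le> lg" using N by (simp add: lg_def)
  have K: "real (fft_exp N) \<le> 3 * lg" unfolding lg_def by (rule fft_exp_le_log[OF N])
  have "real (ops (recursive_inverse s N a)) \<le> real (12 * s ^ 3 * N ^ 2)"
    using rec by (intro of_nat_mono) simp
  also have "\<dots> = 12 * (real s ^ 3 * real N ^ 2)" by simp
  also have "\<dots> \<le> 6000 * (real s ^ 3 * real N ^ 2)" by (rule mult_right_mono) simp_all
  finally show "real (ops (recursive_inverse s N a)) \<le> 6000 * (real s ^ 3 * real N ^ 2)" .
  have "real (ops (newton_inverse s N a)) \<le>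
      real (s * s * N * (192 * fft_exp N + 68) + 71 * s ^ 3 * N)"
    using newton by (intro of_nat_mono) simp
  also have "\<dots> = real s ^ 2 * real N * (192 * real (fft_exp N) + 68) + 71 * (real s ^ 3 * real N)"
    by (simp add: power2_eq_square)
  also have "\<dots> \<le> real s ^ 2 * real N * (6000 * lg) + 6000 * (real s ^ 3 * real N)"
    by (intro add_mono mult_left_mono mult_right_mono) (use K lg in simp_all)
  finally show "real (ops (newton_inverse s N a)) \<le>
      6000 * (real s ^ 2 * real N * log 2 (real N) + real s ^ 3 * real N)"
    by (simp add: lg_def algebra_simps)
  have "real (ops (gauss_jordan_inverse pv s N a)) \<le> real (7 * s ^ 3 * ((192 * fft_exp N + 104) * N))"
    using gj by (intro of_nat_mono) simp
  also have "\<dots> = real s ^ 3 * real N * (7 * (192 * real (fft_exp N) + 104))"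
    by simp
  also have "\<dots> \<le> real s ^ 3 * real N * (6000 * lg)"
    by (rule mult_left_mono) (use K lg in simp_all)
  finally show "real (ops (gauss_jordan_inverse pv s N a)) \<le> 6000 * (real s ^ 3 * real N * log 2 (real N))"
    by (simp add: lg_def algebra_simps)
qed

theorem proposition2p4:
  shows
    "(\<exists>C::real. \<forall>s N (A :: nat \<Rightarrow> complex mat) pv.
        1 \<le> s \<longrightarrow> 2 \<le> N \<longrightarrow> (\<forall>k. A k \<in> carrier_mat s s) \<longrightarrow> invertible_mat (A 0) \<longrightarrow>
        pivot_rule (\<lambda>a :: complex list. a ! 0 \<noteq> 0) pv \<longrightarrow>
        (let a = coeffs N A;
             recursive = recursive_inverse s N a;
             newton = newton_inverse s N a;
             gj = gauss_jordan_inverse pv s N a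
         in result recursive = coeffs N (conv_inverse s A) \<and>
            result newton = coeffs N (conv_inverse s A) \<and>
            result gj = coeffs N (conv_inverse s A) \<and>
            real (ops recursive) \<le> C * (real s ^ 3 * real N ^ 2) \<and>
            real (ops newton) \<le> C * (real s ^ 2 * real N * log 2 (real N) + real s ^ 3 * real N) \<and>
            real (ops gj) \<le> C * (real s ^ 3 * real N * log 2 (real N)) \<and>
            real (storage a recursive) \<le> C * (real s ^ 2 * real N) \<and>
            real (storage a newton) \<le> C * (real s ^ 2 * real N) \<and>
            real (storage a gj) \<le> C * (real s ^ 2 * real N)))
     \<and>
     (\<forall>s\<ge>1. \<exists>C::real. \<forall>N (A :: nat \<Rightarrow> complex mat) pv.
        2 \<le> N \<longrightarrow> (\<forall>k. A k \<in> carrier_mat s s) \<longrightarrow> invertible_mat (A 0) \<longrightarrow>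
        pivot_rule (\<lambda>a :: complex list. a ! 0 \<noteq> 0) pv \<longrightarrow>
        real (ops (newton_inverse s N (coeffs N A))) \<le> C * (real N * log 2 (real N)) \<and>
        real (ops (gauss_jordan_inverse pv s N (coeffs N A))) \<le> C * (real N * log 2 (real N)))"
proof (rule conjI)
  show "\<exists>C::real. \<forall>s N (A :: nat \<Rightarrow> complex mat) pv.
        1 \<le> s \<longrightarrow> 2 \<le> N \<longrightarrow> (\<forall>k. A k \<in> carrier_mat s s) \<longrightarrow> invertible_mat (A 0) \<longrightarrow>
        pivot_rule (\<lambda>a :: complex list. a ! 0 \<noteq> 0) pv \<longrightarrow>
        (let a = coeffs N A;
             recursive = recursive_inverse s N a;
             newton = newton_inverse s N a;
             gj = gauss_jordan_inverse pv s N a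
         in result recursive = coeffs N (conv_inverse s A) \<and>
            result newton = coeffs N (conv_inverse s A) \<and>
            result gj = coeffs N (conv_inverse s A) \<and>
            real (ops recursive) \<le> C * (real s ^ 3 * real N ^ 2) \<and>
            real (ops newton) \<le> C * (real s ^ 2 * real N * log 2 (real N) + real s ^ 3 * real N) \<and>
            real (ops gj) \<le> C * (real s ^ 3 * real N * log 2 (real N)) \<and>
            real (storage a recursive) \<le> C * (real s ^ 2 * real N) \<and>
            real (storage a newton) \<le> C * (real s ^ 2 * real N) \<and>
            real (storage a gj) \<le> C * (real s ^ 2 * real N))"
    unfolding Let_def by (intro exI[of _ 6000] allI impI conjI inversion_bounds) blast+
next
  show "\<forall>s\<ge>1. \<exists>C::real. \<forall>N (A :: nat \<Rightarrow> complex mat) pv.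
        2 \<le> N \<longrightarrow> (\<forall>k. A k \<in> carrier_mat s s) \<longrightarrow> invertible_mat (A 0) \<longrightarrow>
        pivot_rule (\<lambda>a :: complex list. a ! 0 \<noteq> 0) pv \<longrightarrow>
        real (ops (newton_inverse s N (coeffs N A))) \<le> C * (real N * log 2 (real N)) \<and>
        real (ops (gauss_jordan_inverse pv s N (coeffs N A))) \<le> C * (real N * log 2 (real N))"
  proof (intro allI impI)
    fix s :: nat assume s: "1 \<le> s"
    \<comment> \<open>For Newton inversion the term \<open>s ^ 3 * N\<close> is raised to
      \<open>s ^ 3 * N * log 2 N\<close>, so both powers of \<open>s\<close> enter; for elimination
      the square is a nonnegative surplus.\<close>
    let ?C = "6000 * (real s ^ 2 + real s ^ 3)"
    have "real (ops (newton_inverse s N (coeffs N A))) \<le> ?C * (real N * log 2 (real N)) \<and>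
        real (ops (gauss_jordan_inverse pv s N (coeffs N A))) \<le> ?C * (real N * log 2 (real N))"
      if N: "2 \<le> N" and A: "\<forall>k. A k \<in> carrier_mat s s" "invertible_mat (A 0)"
        and pv: "pivot_rule (\<lambda>a :: complex list. a ! 0 \<noteq> 0) pv" for N A pv
    proof
      have "1 \<le> log 2 (real N)" using N by simp
      then have le: "real s ^ 3 * real N * 1 \<le> real s ^ 3 * real N * log 2 (real N)"
        by (rule mult_left_mono) simp
      have nonneg: "0 \<le> real s ^ 2 * real N * log 2 (real N)"
        using N by simp
      note bounds = inversion_bounds(5,6)[where A = A and pv = pv, OF s N A(1)[rule_format] A(2) pv]
      show "real (ops (newton_inverse s N (coeffs N A))) \<le> ?C * (real N * log 2 (real N))"
        using bounds(1) le by (simp add: algebra_simps)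
      show "real (ops (gauss_jordan_inverse pv s N (coeffs N A))) \<le> ?C * (real N * log 2 (real N))"
        using bounds(2) nonneg by (simp add: algebra_simps)
    qed
    then show "\<exists>C::real. \<forall>N (A :: nat \<Rightarrow> complex mat) pv.
        2 \<le> N \<longrightarrow> (\<forall>k. A k \<in> carrier_mat s s) \<longrightarrow> invertible_mat (A 0) \<longrightarrow>
        pivot_rule (\<lambda>a :: complex list. a ! 0 \<noteq> 0) pv \<longrightarrow>
        real (ops (newton_inverse s N (coeffs N A))) \<le> C * (real N * log 2 (real N)) \<and>
        real (ops (gauss_jordan_inverse pv s N (coeffs N A))) \<le> C * (real N * log 2 (real N))"
      by blast
  qed
qed

end
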